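(* Let $X=(\mathbb{S}^1,\mathscr{T})$ be the topological space constructed in the context. Then $X$ is $2$-path-flimsy, but $X\setminus\{x,y\}$ is big-path-connected for all distinct $x,y\in X$.
   Context: Definitions. A big interval is a topological space $L$ whose topology is the order topology of a linear order on $L$ that is dense ($|L|\ge 2$ and for all $x<y$ there is $z$ with $x<z<y$), order-complete (every non-empty subset with an upper bound has a supremum), and has both a minimum and a maximum. A big path on a space from $x$ to $y$ is a continuous map $\gamma$ from a big interval $L$ to it with $\gamma(\min L)=x$ and $\gamma(\max L)=y$. A space is big-path-connected if any two of its points are joined by a big path in it. A topological space $X$ is $2$-path-flimsy if $|X|>2$ and if, for any $S\subseteq X$, the subspace $X\setminus S$ is path-connected (in the usual sense) whenever $|S|<2$ and not path-connected whenever $|S|=2$. Construction of $X$. Let $\mathbb{S}^1$ be the quotient of $[0,3]$ obtained by identifying $0$ and $3$, and let $\mathscr{E}$ be the quotient (Euclidean) topology on it; as a set, $\mathbb{S}^1$ is identified with $[0,3)$. Let $L=[0,1]^{\mathbb{N}}$ with the lexicographic order $<_{\mathrm{lex}}$: for distinct $x=(x_n)_n$ and $y=(y_n)_n$ in $L$, $x<_{\mathrm{lex}}y$ iff $x_N<y_N$ where $N=\min\{n\in\mathbb{N}: x_n\neq y_n\}$. Equip $L$ with the order topology (it is a big interval). Let $\ell_1=(\tfrac13,\tfrac13,\ldots)$ and $\ell_2=(\tfrac23,\tfrac23,\ldots)$, and partition $L$ into $L_1=[\min L,\ell_1]$, $L_2=(\ell_1,\ell_2)$, $L_3=[\ell_2,\max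 L]$. Fix partitions $\{A_1,A_2,A_3\}$ of $L$ and $\{B_1,B_2,B_3\}$ of $\mathbb{S}^1$ such that every closed subset $F\subseteq L\times(\mathbb{S}^1,\mathscr{E})$ either can be covered by countably many subsets of the form $\{\ell\}\times\mathbb{S}^1$ or $L\times\{z\}$ (with $\ell\in L$, $z\in\mathbb{S}^1$), or meets each of the nine sets $A_i\times B_j$, $i,j\in\{1,2,3\}$. (Such partitions exist.) For all $i,j\in\{1,2,3\}$, the sets $A_i\cap L_j$ and $[i-1,i)\cap B_j$ both have cardinality $2^{\aleph_0}$; fix an arbitrary bijection $f_{i,j}\colon A_i\cap L_j\to[i-1,i)\cap B_j$. Let $f\colon L\to\mathbb{S}^1$ be the bijection defined by $f(\ell)=f_{i,j}(\ell)$ if $\ell\in A_i\cap L_j$. Finally, let $$\mathscr{T}:=\{U\subseteq\mathbb{S}^1 : U\text{ is open in }(\mathbb{S}^1,\mathscr{E})\text{ and } f^{-1}(U)\text{ is open in }L\},$$ and let $X=(\mathbb{S}^1,\mathscr{T})$. *)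

theory Defs
  imports "HOL-Analysis.Analysis" "HOL-Library.Fun_Lexorder"
begin

definition order_topology_on :: "'b set \<Rightarrow> ('b \<times> 'b) set \<Rightarrow> 'b topology" where
  "order_topology_on A r =
     topology_generated_by
       (insert A ((\<lambda>a. {x \<in> A. (x, a) \<in> r \<and> x \<noteq> a}) ` A \<union> (\<lambda>a. {x \<in> A. (a, x) \<in> r \<and> x \<noteq> a}) ` A))"

definition is_min_of :: "'b set \<Rightarrow> ('b \<times> 'b) set \<Rightarrow> 'b \<Rightarrow> bool" where
  "is_min_of A r m \<longleftrightarrow> m \<in> A \<and> (\<forall>x\<in>A. (m, x) \<in> r)"

definition is_max_of :: "'b set \<Rightarrow> ('b \<times> 'b) set \<Rightarrow> 'b \<Rightarrow> bool" where
  "is_max_of A r m \<longleftrightarrow> m \<in> A \<and> (\<forall>x\<in>A. (x, m) \<in> r)"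

definition upper_bounds_of :: "'b set \<Rightarrow> ('b \<times> 'b) set \<Rightarrow> 'b set \<Rightarrow> 'b set" where
  "upper_bounds_of A r S = {u \<in> A. \<forall>s\<in>S. (s, u) \<in> r}"

definition dense_order_on :: "'b set \<Rightarrow> ('b \<times> 'b) set \<Rightarrow> bool" where
  "dense_order_on A r \<longleftrightarrow>
     (\<exists>x\<in>A. \<exists>y\<in>A. x \<noteq> y) \<and>
     (\<forall>x\<in>A. \<forall>y\<in>A. (x, y) \<in> r \<and> x \<noteq> y \<longrightarrow>
        (\<exists>z\<in>A. (x, z) \<in> r \<and> x \<noteq> z \<and> (z, y) \<in> r \<and> z \<noteq> y))"

definition complete_order_on :: "'b set \<Rightarrow> ('b \<times> 'b) set \<Rightarrow> bool" where
  "complete_order_on A r \<longleftrightarrow>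
     (\<forall>S\<subseteq>A. S \<noteq> {} \<and> upper_bounds_of A r S \<noteq> {} \<longrightarrow>
        (\<exists>s. is_min_of (upper_bounds_of A r S) r s))"

text \<open>The (reflexive) order is part of the data, because it determines which end point is the
  minimum and which is the maximum.\<close>

definition big_interval :: "'b topology \<Rightarrow> ('b \<times> 'b) set \<Rightarrow> bool" where
  "big_interval T r \<longleftrightarrow>
     linear_order_on (topspace T) r \<and>
     dense_order_on (topspace T) r \<and>
     complete_order_on (topspace T) r \<and>
     (\<exists>m. is_min_of (topspace T) r m) \<and>
     (\<exists>m. is_max_of (topspace T) r m) \<and>
     T = order_topology_on (topspace T) r"

definition big_path ::
  "'b topology \<Rightarrow> ('b \<times> 'b) set \<Rightarrow> 'a topology \<Rightarrow> ('b \<Rightarrow> 'a) \<Rightarrow> 'a \<Rightarrow> 'a \<Rightarrow> bool" where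
  "big_path T r Y \<gamma> x y \<longleftrightarrow>
     big_interval T r \<and> continuous_map T Y \<gamma> \<and>
     (\<forall>m. is_min_of (topspace T) r m \<longrightarrow> \<gamma> m = x) \<and>
     (\<forall>m. is_max_of (topspace T) r m \<longrightarrow> \<gamma> m = y)"

text \<open>HOL cannot quantify over all types inside a formula, so the type whose subsets serve as the
  underlying sets of the big intervals is a parameter. Every instance of the type parameter implies
  the unrestricted notion.\<close>

definition big_path_connected_space :: "'b itself \<Rightarrow> 'a topology \<Rightarrow> bool" where
  "big_path_connected_space (_ :: 'b itself) Y \<longleftrightarrow>
     (\<forall>x\<in>topspace Y. \<forall>y\<in>topspace Y.
        \<exists>(T :: 'b topology) r \<gamma>. big_path T r Y \<gamma> x y)"

definition two_path_flimsy :: "'a topology \<Rightarrow> bool" where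
  "two_path_flimsy X \<longleftrightarrow>
     (infinite (topspace X) \<or> card (topspace X) > 2) \<and>
     (\<forall>S\<subseteq>topspace X.
        (finite S \<and> card S < 2 \<longrightarrow>
           path_connected_space (subtopology X (topspace X - S))) \<and>
        (finite S \<and> card S = 2 \<longrightarrow>
           \<not> path_connected_space (subtopology X (topspace X - S))))"

definition quotient_topology :: "'a topology \<Rightarrow> ('a \<Rightarrow> 'b) \<Rightarrow> 'b topology" where
  "quotient_topology X q =
     topology (\<lambda>U. U \<subseteq> q ` topspace X \<and> openin X {x \<in> topspace X. q x \<in> U})"

lemma openin_quotient_topology:
  "openin (quotient_topology X q) U \<longleftrightarrow>
     U \<subseteq> q ` topspace X \<and> openin X {x \<in> topspace X. q x \<in> U}"
proof -
  have "istopology (\<lambda>U. U \<subseteq> q ` topspace X \<and> openin X {x \<in> topspace X. q x \<in> U})"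
    unfolding istopology_def
  proof (intro conjI allI impI)
    fix S T
    assume "S \<subseteq> q ` topspace X \<and> openin X {x \<in> topspace X. q x \<in> S}"
      and "T \<subseteq> q ` topspace X \<and> openin X {x \<in> topspace X. q x \<in> T}"
    moreover have "{x \<in> topspace X. q x \<in> S \<inter> T} =
        {x \<in> topspace X. q x \<in> S} \<inter> {x \<in> topspace X. q x \<in> T}" by auto
    ultimately show "S \<inter> T \<subseteq> q ` topspace X" "openin X {x \<in> topspace X. q x \<in> S \<inter> T}"
      by auto
  next
    fix K
    assume K: "\<forall>S\<in>K. S \<subseteq> q ` topspace X \<and> openin X {x \<in> topspace X. q x \<in> S}"
    have "{x \<in> topspace X. q x \<in> \<Union>K} = (\<Union>S\<in>K. {x \<in> topspace X. q x \<in> S})" by auto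
    with K show "\<Union>K \<subseteq> q ` topspace X" "openin X {x \<in> topspace X. q x \<in> \<Union>K}"
      by auto
  qed
  then show ?thesis
    unfolding quotient_topology_def by (simp add: topology_inverse')
qed

lemma topspace_quotient_topology [simp]: "topspace (quotient_topology X q) = q ` topspace X"
proof
  show "topspace (quotient_topology X q) \<subseteq> q ` topspace X"
    using openin_quotient_topology[of X q "topspace (quotient_topology X q)"] by simp
  have "{x \<in> topspace X. q x \<in> q ` topspace X} = topspace X" by auto
  then have "openin (quotient_topology X q) (q ` topspace X)"
    by (simp add: openin_quotient_topology)
  then show "q ` topspace X \<subseteq> topspace (quotient_topology X q)"
    by (rule openin_subset)
qed

lemma quotient_map_quotient_topology: "quotient_map X (quotient_topology X q) q"
  by (simp add: quotient_map_def openin_quotient_topology)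

definition circle :: "real set" where
  "circle = {0..<3}"

definition circle_proj :: "real \<Rightarrow> real" where
  "circle_proj t = (if t = 3 then 0 else t)"

definition circle_top :: "real topology" where
  "circle_top = quotient_topology (top_of_set {0..3}) circle_proj"

lemma topspace_circle_top [simp]: "topspace circle_top = circle"
proof -
  have "circle_proj ` {0..3} = {0..<3}"
    by (force simp: circle_proj_def image_iff)
  then show ?thesis by (simp add: circle_top_def circle_def)
qed

definition lex_set :: "(nat \<Rightarrow> real) set" where
  "lex_set = {x. \<forall>n. x n \<in> {0..1}}"

definition lex_order :: "((nat \<Rightarrow> real) \<times> (nat \<Rightarrow> real)) set" where
  "lex_order = {(x, y). x \<in> lex_set \<and> y \<in> lex_set \<and> (x = y \<or> less_fun x y)}"

definition lex_top :: "(nat \<Rightarrow> real) topology" where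
  "lex_top = order_topology_on lex_set lex_order"

lemma topspace_lex_top [simp]: "topspace lex_top = lex_set"
  unfolding lex_top_def order_topology_on_def topology_generated_by_topspace by auto

definition ell1 :: "nat \<Rightarrow> real" where "ell1 = (\<lambda>_. 1/3)"

definition ell2 :: "nat \<Rightarrow> real" where "ell2 = (\<lambda>_. 2/3)"

text \<open>\<open>lex_part 1\<close>, \<open>lex_part 2\<close>, \<open>lex_part 3\<close> are the intervals
  \<open>[min L, ell1]\<close>, \<open>(ell1, ell2)\<close>, \<open>[ell2, max L]\<close>; other indices are never used.\<close>

definition lex_part :: "nat \<Rightarrow> (nat \<Rightarrow> real) set" where
  "lex_part j =
     (if j = 1 then {x \<in> lex_set. (x, ell1) \<in> lex_order}
      else if j = 2 then {x \<in> lex_set. less_fun ell1 x \<and> less_fun x ell2}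
      else {x \<in> lex_set. (ell2, x) \<in> lex_order})"

definition indexed_partition3 :: "'a set \<Rightarrow> (nat \<Rightarrow> 'a set) \<Rightarrow> bool" where
  "indexed_partition3 S P \<longleftrightarrow>
     (\<Union>i\<in>{1..3}. P i) = S \<and> disjoint_family_on P {1..3} \<and> (\<forall>i\<in>{1..3}. P i \<noteq> {})"

definition countably_line_covered :: "((nat \<Rightarrow> real) \<times> real) set \<Rightarrow> bool" where
  "countably_line_covered F \<longleftrightarrow>
     (\<exists>\<C>. countable \<C> \<and> F \<subseteq> \<Union>\<C> \<and>
        (\<forall>C\<in>\<C>. (\<exists>l\<in>lex_set. C = {l} \<times> circle) \<or> (\<exists>z\<in>circle. C = lex_set \<times> {z})))"

definition flimsy_top :: "((nat \<Rightarrow> real) \<Rightarrow> real) \<Rightarrow> real topology" where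
  "flimsy_top f =
     topology (\<lambda>U. openin circle_top U \<and> openin lex_top {l \<in> lex_set. f l \<in> U})"

lemma openin_flimsy_top:
  "openin (flimsy_top f) U \<longleftrightarrow>
     openin circle_top U \<and> openin lex_top {l \<in> lex_set. f l \<in> U}"
proof -
  have "istopology (\<lambda>U. openin circle_top U \<and> openin lex_top {l \<in> lex_set. f l \<in> U})"
    unfolding istopology_def
  proof (intro conjI allI impI)
    fix S T
    assume "openin circle_top S \<and> openin lex_top {l \<in> lex_set. f l \<in> S}"
      and "openin circle_top T \<and> openin lex_top {l \<in> lex_set. f l \<in> T}"
    moreover have "{l \<in> lex_set. f l \<in> S \<inter> T} =
        {l \<in> lex_set. f l \<in> S} \<inter> {l \<in> lex_set. f l \<in> T}" by auto
    ultimately show "openin circle_top (S \<inter> T)" "openin lex_top {l \<in> lex_set. f l \<in> S \<inter> T}"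
      by auto
  next
    fix K
    assume K: "\<forall>S\<in>K. openin circle_top S \<and> openin lex_top {l \<in> lex_set. f l \<in> S}"
    have "{l \<in> lex_set. f l \<in> \<Union>K} = (\<Union>S\<in>K. {l \<in> lex_set. f l \<in> S})" by auto
    with K show "openin circle_top (\<Union>K)" "openin lex_top {l \<in> lex_set. f l \<in> \<Union>K}"
      by auto
  qed
  then show ?thesis
    unfolding flimsy_top_def by (simp add: topology_inverse')
qed

lemma topspace_flimsy_top:
  assumes "f ` lex_set \<subseteq> circle"
  shows "topspace (flimsy_top f) = circle"
proof
  show "topspace (flimsy_top f) \<subseteq> circle"
    using openin_flimsy_top[of f "topspace (flimsy_top f)"] openin_subset[of circle_top]
    by auto
  have "{l \<in> lex_set. f l \<in> circle} = topspace lex_top"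
    using assms by auto
  then have "openin (flimsy_top f) circle"
    using openin_topspace[of circle_top] openin_topspace[of lex_top]
    by (simp add: openin_flimsy_top)
  then show "circle \<subseteq> topspace (flimsy_top f)"
    by (rule openin_subset)
qed

end

theory Submission
  imports Defs
begin

text \<open>
  Write \<open>E\<close> for the Euclidean topology of the circle and transport the order topology of \<open>L\<close> to the
  circle along \<open>f\<close>; the topology of \<open>X\<close> is the intersection of the two. Hence every map that is
  continuous for one of them is continuous into \<open>X\<close>. In particular \<open>X\<close> minus at most one point is
  path-connected, because the same is true of the Euclidean circle.

  The main point is that, conversely, every path \<open>\<gamma>\<close> in \<open>X\<close> is continuous for \<open>E\<close>
  (\<open>path_continuous_on_circle\<close>); so removing two points disconnects \<open>X\<close> for paths. The proof has
  four ingredients.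

  First, both topologies are sequentially compact. If a sequence converges to \<open>z\<close> for \<open>E\<close> and to \<open>l\<close>
  in \<open>L\<close>, then adding \<open>z\<close> and \<open>f l\<close> to it yields a closed set of \<open>X\<close>. It follows that for
  neighbourhoods \<open>U\<close>, \<open>V\<close> of \<open>\<gamma> t\<close> in the two topologies, \<open>\<gamma> s\<close> lies in \<open>U\<close> or in \<open>V\<close> for all \<open>s\<close> near
  \<open>t\<close> (\<open>disjunctive_continuity\<close>).

  Second, the property of the nine products: a path on \<open>[a,b]\<close> that misses one of the arcs
  \<open>[i-1,i)\<close> and whose preimage under \<open>f\<close> misses one of the three parts of \<open>L\<close> is constant
  (\<open>constant_of_small\<close>). The closure \<open>F\<close> of \<open>{(f\<inverse>(\<gamma> t), \<gamma> t) | t}\<close> in \<open>L \<times> S\<^sup>1\<close> contains only points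
  \<open>(l, z)\<close> such that \<open>f l\<close> or \<open>z\<close> lies on the path, so it misses \<open>A\<^sub>i \<times> B\<^sub>j\<close>. Hence \<open>F\<close> is covered
  by countably many lines, each of which contains at most one point of the graph, and \<open>\<gamma>\<close> takes
  countably many values; by a theorem of Sierpinski it is constant.

  Third, a connectedness argument for functions that are continuous in the disjunctive sense
  (\<open>isCont_of_disjunctive_continuity\<close>): if \<open>\<gamma>\<close> is locally constant at each point near which \<open>g\<close> stays in
  some fixed neighbourhood of \<open>g t\<close>, then \<open>\<gamma>\<close> is continuous at \<open>t\<close>.

  Fourth, every path in \<open>L\<close> is constant, since each nondegenerate interval of \<open>L\<close> contains
  uncountably many disjoint open intervals (\<open>lexcube_path_constant\<close>). Where the preimage of the path
  misses a part of \<open>L\<close>, the second and third ingredients make the path continuous into \<open>L\<close>, hence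
  constant. A second use of the third ingredient, with the roles of the two topologies exchanged,
  gives continuity for \<open>E\<close>.

  For big paths, one of the three parts \<open>L\<^sub>j\<close> contains neither \<open>f\<inverse>(x)\<close> nor \<open>f\<inverse>(y)\<close>. The product
  property shows that \<open>f(L\<^sub>j) = B\<^sub>j\<close> meets both arcs between \<open>x\<close> and \<open>y\<close>, so an interval of \<open>L\<close>
  inside \<open>L\<^sub>j\<close> is mapped by \<open>f\<close> to a big path from one arc to the other. Together with ordinary paths
  inside the arcs this joins all points. All big paths used are parametrised by \<open>L\<close> itself.
\<close>

section \<open>The lexicographic cube as a complete linear order\<close>

lemma less_fun_linear: "(x::nat \<Rightarrow> real) = y \<or> less_fun x y \<or> less_fun y x"
proof (cases "x = y")
  case False
  then have "\<exists>n. x n \<noteq> y n" by auto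
  then obtain n where n: "x n \<noteq> y n" "\<And>k. k < n \<Longrightarrow> \<not> x k \<noteq> y k"
    using exists_least_iff[of "\<lambda>n. x n \<noteq> y n"] by blast
  then show ?thesis unfolding less_fun_def by (metis linorder_neqE)
qed auto

text \<open>The set \<open>L\<close> as a type of its own, so that its order and its topology become instances of the type
  classes for linear orders and order topologies.\<close>

typedef lexcube = lex_set
  by (rule exI[of _ "\<lambda>_. 0"]) (simp add: lex_set_def)

abbreviation coord :: "lexcube \<Rightarrow> nat \<Rightarrow> real" where "coord \<equiv> Rep_lexcube"

lemma coord_bounds [simp]: "0 \<le> coord x n" "coord x n \<le> 1"
  using Rep_lexcube[of x] by (auto simp: lex_set_def)

lemma coord_Abs: "(\<And>n. 0 \<le> u n \<and> u n \<le> 1) \<Longrightarrow> coord (Abs_lexcube u) = u"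
  by (rule Abs_lexcube_inverse) (auto simp: lex_set_def)

instantiation lexcube :: linorder
begin
definition less_lexcube where "x < y \<longleftrightarrow> less_fun (coord x) (coord y)"
definition less_eq_lexcube where "x \<le> (y::lexcube) \<longleftrightarrow> x = y \<or> x < y"
instance
proof
  fix x y z :: lexcube
  show "(x < y) = (x \<le> y \<and> \<not> y \<le> x)" "x \<le> x" "x \<le> y \<or> y \<le> x"
      "x \<le> y \<Longrightarrow> y \<le> x \<Longrightarrow> x = y"
    using less_fun_irrefl less_fun_asym less_fun_linear[of "coord x" "coord y"]
    by (auto simp: less_eq_lexcube_def less_lexcube_def Rep_lexcube_inject)
  show "x \<le> y \<Longrightarrow> y \<le> z \<Longrightarrow> x \<le> z"
    using less_fun_trans by (auto simp: less_eq_lexcube_def less_lexcube_def)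
qed
end

lemma less_lexcube_iff:
  "x < y \<longleftrightarrow> (\<exists>n. coord x n < coord y n \<and> (\<forall>i<n. coord x i = coord y i))"
  by (simp add: less_lexcube_def less_fun_def)

text \<open>The coordinates of the supremum of \<open>S\<close>, from left to right: the \<open>n\<close>-th one is the supremum of the
  \<open>n\<close>-th coordinates of those elements of \<open>S\<close> that agree with the earlier ones. The additional \<open>0\<close> is
  the value from the first index on at which no such element is left; it does not change the supremum
  of a nonempty set of coordinates.\<close>

function sup_coord :: "lexcube set \<Rightarrow> nat \<Rightarrow> real" where
  "sup_coord S n = Sup (insert 0 {v. \<exists>x\<in>S. v = coord x n \<and> (\<forall>i\<in>{..<n}. coord x i = sup_coord S i)})"
  by auto
termination by (relation "Wellfounded.measure snd") auto

declare sup_coord.simps [simp del]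

lemma sup_coord_set_bdd: "bdd_above (insert 0 {v. \<exists>x\<in>S. v = coord x n \<and> P x})"
  by (rule bdd_aboveI[of _ 1]) auto

lemma sup_coord_bounds: "0 \<le> sup_coord S n \<and> sup_coord S n \<le> 1"
  unfolding sup_coord.simps[of S n]
  by (auto intro!: cSup_upper cSup_least sup_coord_set_bdd)

lemma coord_Abs_sup: "coord (Abs_lexcube (sup_coord S)) = sup_coord S"
  by (rule coord_Abs) (rule sup_coord_bounds)

lemma lex_sup_upper:
  assumes "x \<in> S" shows "x \<le> Abs_lexcube (sup_coord S)"
proof (rule ccontr)
  assume "\<not> ?thesis"
  then obtain n where n: "sup_coord S n < coord x n" "\<forall>i<n. sup_coord S i = coord x i"
    by (auto simp: not_le less_lexcube_iff coord_Abs_sup)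
  have "coord x n \<le> sup_coord S n"
    unfolding sup_coord.simps[of S n] using n(2) assms
    by (intro cSup_upper sup_coord_set_bdd) auto
  with n(1) show False by simp
qed

lemma lex_sup_least:
  assumes "\<And>x. x \<in> S \<Longrightarrow> x \<le> u" shows "Abs_lexcube (sup_coord S) \<le> u"
proof (rule ccontr)
  assume "\<not> ?thesis"
  then obtain n where n: "coord u n < sup_coord S n" "\<forall>i<n. coord u i = sup_coord S i"
    by (auto simp: not_le less_lexcube_iff coord_Abs_sup)
  have "\<exists>v\<in>insert 0 {v. \<exists>x\<in>S. v = coord x n \<and> (\<forall>i\<in>{..<n}. coord x i = sup_coord S i)}.
          coord u n < v"
    using n(1) unfolding sup_coord.simps[of S n]
    by (subst (asm) less_cSup_iff) (auto intro: sup_coord_set_bdd simp del: bdd_above_insert)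
  then obtain v where v: "v = 0 \<or> (\<exists>x\<in>S. v = coord x n \<and> (\<forall>i<n. coord x i = sup_coord S i))"
      "coord u n < v" by auto
  with coord_bounds(1)[of u n] obtain x where
    "x \<in> S" "coord u n < coord x n" "\<forall>i<n. coord x i = sup_coord S i"
    by (auto simp del: coord_bounds)
  with n(2) have "u < x" unfolding less_lexcube_iff by (intro exI[of _ n]) auto
  with assms[OF \<open>x \<in> S\<close>] show False by simp
qed

instantiation lexcube :: complete_linorder
begin
definition Sup_lexcube where "Sup S = Abs_lexcube (sup_coord S)"
definition Inf_lexcube where "Inf (S::lexcube set) = Sup {l. \<forall>x\<in>S. l \<le> x}"
definition sup_lexcube where "sup x (y::lexcube) = max x y"
definition inf_lexcube where "inf x (y::lexcube) = min x y"
definition bot_lexcube where "bot = (Sup {} :: lexcube)"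
definition top_lexcube where "top = (Inf {} :: lexcube)"
instance
  by standard (auto simp: sup_lexcube_def inf_lexcube_def Sup_lexcube_def Inf_lexcube_def
      bot_lexcube_def top_lexcube_def intro!: lex_sup_upper lex_sup_least)
end

instance lexcube :: dense_linorder
proof
  fix x y :: lexcube
  assume "x < y"
  then obtain n where n: "coord x n < coord y n" "\<forall>i<n. coord x i = coord y i"
    by (auto simp: less_lexcube_iff)
  define z where "z = Abs_lexcube ((coord x)(n := (coord x n + coord y n) / 2))"
  have "coord z = (coord x)(n := (coord x n + coord y n) / 2)"
    unfolding z_def using add_mono[OF coord_bounds(2)[of x n] coord_bounds(2)[of y n]]
    by (intro coord_Abs) auto
  with n have "x < z \<and> z < y"
    unfolding less_lexcube_iff by (auto intro!: exI[of _ n])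
  then show "\<exists>z. x < z \<and> z < y" by blast
qed

instantiation lexcube :: linorder_topology
begin
definition open_lexcube :: "lexcube set \<Rightarrow> bool" where
  "open_lexcube = generate_topology (range (\<lambda>a. {..<a}) \<union> range (\<lambda>a. {a<..}))"
instance by standard (rule open_lexcube_def)
end

instance lexcube :: t3_space
proof
  fix S and y :: lexcube
  assume "closed S" "y \<notin> S"
  then have o: "open (- S)" "y \<in> - S" by auto
  have "\<exists>U C. open U \<and> closed C \<and> y \<in> U \<and> U \<subseteq> C \<and> C \<inter> {..y} \<inter> S = {}"
  proof (cases "\<exists>a. a < y")
    case True
    then obtain a where a: "a < y" "{a<..y} \<subseteq> - S" using open_left[OF o] by blast
    then obtain b where "a < b" "b < y" using dense by blast
    have "x \<notin> S" if "b \<le> x" "x \<le> y" for x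
      using subsetD[OF a(2), of x] that \<open>a < b\<close> by auto
    with \<open>b < y\<close> show ?thesis
      by - (rule exI[of _ "{b<..}"], rule exI[of _ "{b..}"], auto)
  next
    case False
    then have "{..y} = {y}" by (auto simp: order_le_less)
    with o show ?thesis
      by - (rule exI[of _ UNIV], rule exI[of _ UNIV], auto)
  qed
  moreover have "\<exists>U C. open U \<and> closed C \<and> y \<in> U \<and> U \<subseteq> C \<and> C \<inter> {y..} \<inter> S = {}"
  proof (cases "\<exists>a. y < a")
    case True
    then obtain a where a: "y < a" "{y..<a} \<subseteq> - S" using open_right[OF o] by blast
    then obtain b where "y < b" "b < a" using dense by blast
    have "x \<notin> S" if "y \<le> x" "x \<le> b" for x
      using subsetD[OF a(2), of x] that \<open>b < a\<close> by auto
    with \<open>y < b\<close> show ?thesis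
      by - (rule exI[of _ "{..<b}"], rule exI[of _ "{..b}"], auto)
  next
    case False
    then have "{y..} = {y}" by (auto simp: order_le_less)
    with o show ?thesis
      by - (rule exI[of _ UNIV], rule exI[of _ UNIV], auto)
  qed
  ultimately obtain U C U' C' where "open U" "closed C" "y \<in> U" "U \<subseteq> C" "C \<inter> {..y} \<inter> S = {}"
      "open U'" "closed C'" "y \<in> U'" "U' \<subseteq> C'" "C' \<inter> {y..} \<inter> S = {}" by blast
  moreover then have "S \<subseteq> - (C \<inter> C')"
    using linear[of _ y] by (force simp: disjoint_iff)
  ultimately show "\<exists>U V. open U \<and> open V \<and> y \<in> U \<and> S \<subseteq> V \<and> U \<inter> V = {}"
    by - (rule exI[of _ "U \<inter> U'"], rule exI[of _ "- (C \<inter> C')"], auto)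
qed

text \<open>Sequential compactness: every sequence has a monotone subsequence, which converges by completeness.\<close>

lemma lexcube_convergent_subsequence:
  fixes x :: "nat \<Rightarrow> lexcube"
  obtains r l where "strict_mono r" "(x \<circ> r) \<longlonglongrightarrow> l"
proof -
  obtain r where r: "strict_mono r" "monoseq (\<lambda>n. x (r n))" using seq_monosub by blast
  then consider "incseq (x \<circ> r)" | "decseq (x \<circ> r)"
    by (auto simp: monoseq_iff comp_def)
  then show thesis
    using r(1) that LIMSEQ_SUP LIMSEQ_INF by cases blast+
qed

lemma lex_order_iff: "(coord x, coord y) \<in> lex_order \<longleftrightarrow> x \<le> y"
  using Rep_lexcube
  by (simp add: lex_order_def less_eq_lexcube_def less_lexcube_def Rep_lexcube_inject)

lemma lex_order_less_iff:
  assumes "x \<in> lex_set"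
  shows "(x, coord a) \<in> lex_order \<and> x \<noteq> coord a \<longleftrightarrow> Abs_lexcube x < a"
    "(coord a, x) \<in> lex_order \<and> coord a \<noteq> x \<longleftrightarrow> a < Abs_lexcube x"
proof -
  obtain y where y: "x = coord y" using assms Abs_lexcube_inverse by metis
  show "(x, coord a) \<in> lex_order \<and> x \<noteq> coord a \<longleftrightarrow> Abs_lexcube x < a"
    "(coord a, x) \<in> lex_order \<and> coord a \<noteq> x \<longleftrightarrow> a < Abs_lexcube x"
    unfolding y Rep_lexcube_inverse lex_order_iff Rep_lexcube_inject order_less_le by blast+
qed

lemma homeomorphic_map_lex_top: "homeomorphic_map lex_top euclidean Abs_lexcube"
proof -
  have 1: "continuous_map lex_top euclidean Abs_lexcube"
  proof -
    have "openin lex_top {x \<in> lex_set. Abs_lexcube x \<in> S}" if "open S" for S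
      using that unfolding open_lexcube_def
    proof (induction rule: generate_topology.induct)
      case UNIV
      then show ?case using openin_topspace[of lex_top] by simp
    next
      case (Int A B)
      have "{x \<in> lex_set. Abs_lexcube x \<in> A \<inter> B} =
          {x \<in> lex_set. Abs_lexcube x \<in> A} \<inter> {x \<in> lex_set. Abs_lexcube x \<in> B}" by auto
      with Int show ?case by auto
    next
      case (UN K)
      have "{x \<in> lex_set. Abs_lexcube x \<in> \<Union>K} = (\<Union>A\<in>K. {x \<in> lex_set. Abs_lexcube x \<in> A})" by auto
      with UN show ?case by auto
    next
      case (Basis A)
      then obtain a where a: "A = {..<a} \<or> A = {a<..}" by auto
      have sub: "openin lex_top {x \<in> lex_set. (x, u) \<in> lex_order \<and> x \<noteq> u}"
          "openin lex_top {x \<in> lex_set. (u, x) \<in> lex_order \<and> u \<noteq> x}" if "u \<in> lex_set" for u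
        using that unfolding lex_top_def order_topology_on_def
        by (auto intro!: topology_generated_by_Basis)
      have eq: "{x \<in> lex_set. Abs_lexcube x \<in> {..<a}} =
          {x \<in> lex_set. (x, coord a) \<in> lex_order \<and> x \<noteq> coord a}"
        "{x \<in> lex_set. Abs_lexcube x \<in> {a<..}} =
          {x \<in> lex_set. (coord a, x) \<in> lex_order \<and> coord a \<noteq> x}"
        by (intro Collect_cong conj_cong refl; simp only: lex_order_less_iff lessThan_iff greaterThan_iff)+
      from a show ?case
        using sub[OF Rep_lexcube[of a]] by (elim disjE) (simp_all only: eq)
    qed
    then show ?thesis by (auto simp: continuous_map_def)
  qed
  have 2: "continuous_map euclidean lex_top coord"
    unfolding lex_top_def order_topology_on_def
  proof (rule continuous_on_generated_topo)
    fix U assume "U \<in> insert lex_set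
       ((\<lambda>a. {x \<in> lex_set. (x, a) \<in> lex_order \<and> x \<noteq> a}) ` lex_set \<union>
        (\<lambda>a. {x \<in> lex_set. (a, x) \<in> lex_order \<and> x \<noteq> a}) ` lex_set)"
    then consider "U = lex_set" | a where "a \<in> lex_set" "U = {x \<in> lex_set. (x, a) \<in> lex_order \<and> x \<noteq> a}"
      | a where "a \<in> lex_set" "U = {x \<in> lex_set. (a, x) \<in> lex_order \<and> x \<noteq> a}" by auto
    then show "openin euclidean (coord -` U \<inter> topspace euclidean)"
    proof cases
      case 1
      then have "coord -` U = UNIV" using Rep_lexcube by auto
      then show ?thesis by simp
    next
      case 2
      have "coord y \<in> U \<longleftrightarrow> y \<in> {..<Abs_lexcube a}" for y
        using lex_order_less_iff(1)[OF Rep_lexcube, of y "Abs_lexcube a"]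
        unfolding 2(2) Abs_lexcube_inverse[OF 2(1)] Rep_lexcube_inverse
        by (simp add: Rep_lexcube)
      then have "coord -` U = {..<Abs_lexcube a}" by blast
      then show ?thesis by simp
    next
      case 3
      have "coord y \<in> U \<longleftrightarrow> y \<in> {Abs_lexcube a<..}" for y
        using lex_order_less_iff(2)[OF Rep_lexcube, of "Abs_lexcube a" y]
        unfolding 3(2) Abs_lexcube_inverse[OF 3(1)] Rep_lexcube_inverse
        by (simp add: Rep_lexcube eq_commute)
      then have "coord -` U = {Abs_lexcube a<..}" by blast
      then show ?thesis by simp
    qed
  qed (use Rep_lexcube in auto)
  show ?thesis
  proof (rule homeomorphic_maps_imp_map)
    show "homeomorphic_maps lex_top euclidean Abs_lexcube coord"
      unfolding homeomorphic_maps_def using 1 2 Abs_lexcube_inverse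
      by (simp add: Rep_lexcube_inverse)
  qed
qed

lemma openin_lex_top_iff:
  "openin lex_top U \<longleftrightarrow> (\<exists>W. open W \<and> U = {l \<in> lex_set. Abs_lexcube l \<in> W})"
proof
  assume U: "openin lex_top U"
  then have sub: "U \<subseteq> lex_set" using openin_subset[of lex_top U] by simp
  have "open (Abs_lexcube ` U)"
    using homeomorphic_map_openness[OF homeomorphic_map_lex_top, of U] U sub by simp
  moreover have "U = {l \<in> lex_set. Abs_lexcube l \<in> Abs_lexcube ` U}"
    using sub by (auto simp: image_iff Abs_lexcube_inject subset_eq) 
  ultimately show "\<exists>W. open W \<and> U = {l \<in> lex_set. Abs_lexcube l \<in> W}" by blast
next
  assume "\<exists>W. open W \<and> U = {l \<in> lex_set. Abs_lexcube l \<in> W}"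
  then show "openin lex_top U"
    using openin_continuous_map_preimage[OF homeomorphic_imp_continuous_map[OF homeomorphic_map_lex_top]]
    by auto
qed

text \<open>Paths in \<open>L\<close> are constant. If \<open>g x < g y\<close> first differ at the coordinate \<open>N\<close>, then for each real \<open>c\<close>
  strictly between their \<open>N\<close>-th coordinates the elements beginning with the common prefix followed by
  \<open>c\<close> contain a nonempty open interval between \<open>g x\<close> and \<open>g y\<close>. The preimages of these
  uncountably many disjoint intervals would be disjoint nonempty open sets of reals.\<close>

lemma lexcube_path_constant:
  fixes g :: "real \<Rightarrow> lexcube"
  assumes g: "continuous_on S g" and S: "open S" "connected S" and ab: "a \<in> S" "b \<in> S"
  shows "g a = g b"
proof -
  have no_less: False if xy: "x \<in> S" "y \<in> S" "g x < g y" for x y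
  proof -
    from xy(3) obtain N where N: "coord (g x) N < coord (g y) N" "\<forall>i<N. coord (g x) i = coord (g y) i"
      by (auto simp: less_lexcube_iff)
    define I where "I = {coord (g x) N<..<coord (g y) N}"
    define p where "p w c = Abs_lexcube (\<lambda>i. if i < N then coord (g x) i else if i = N then c else w)"
      for w c :: real
    have coord_p: "coord (p w c) i = (if i < N then coord (g x) i else if i = N then c else w)"
      if "c \<in> I" "w \<in> {0, 1}" for w c i
    proof -
      have "0 \<le> c" "c \<le> 1"
        using that coord_bounds(1)[of "g x" N] coord_bounds(2)[of "g y" N] by (auto simp: I_def simp del: coord_bounds)
      then show ?thesis unfolding p_def using that by (subst coord_Abs) auto
    qed
    have p1: "p 1 c < p 0 d" if "c \<in> I" "d \<in> I" "c < d" for c d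
      unfolding less_lexcube_iff using that by (intro exI[of _ N]) (auto simp: coord_p)
    have p2: "p 0 c < p 1 c" if "c \<in> I" for c
      unfolding less_lexcube_iff using that by (intro exI[of _ "Suc N"]) (auto simp: coord_p)
    have p3: "g x < p 0 c" "p 1 c < g y" if "c \<in> I" for c
      unfolding less_lexcube_iff using that N(2)
      by (intro exI[of _ N]; auto simp: coord_p; simp add: I_def)+
    define T where "T c = S \<inter> g -` {p 0 c<..<p 1 c}" for c
    have T_open: "open (T c)" for c
      unfolding T_def using g S(1) by (rule continuous_open_preimage) simp
    have T_ne: "T c \<noteq> {}" if c: "c \<in> I" for c
    proof -
      obtain z where z: "p 0 c < z" "z < p 1 c" using dense[OF p2[OF c]] by blast
      have "{g x..g y} \<subseteq> g ` S"
        using xy by (intro connected_contains_Icc connected_continuous_image g S) auto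
      moreover have "z \<in> {g x..g y}" using z p3[OF c] by auto
      ultimately obtain r where "r \<in> S" "z = g r" by blast
      then show ?thesis using z by (auto simp: T_def)
    qed
    have T_disj: "T c \<inter> T d = {}" if "c \<in> I" "d \<in> I" "c < d" for c d
      using p1[OF that] by (auto simp: T_def)
    then have disj: "T c \<inter> T d = {}" if "c \<in> I" "d \<in> I" "c \<noteq> d" for c d
      using that by (metis Int_commute linorder_neqE)
    have "countable (T ` I)"
    proof (rule countable_disjoint_open_subsets)
      show "pairwise disjnt (T ` I)"
        unfolding pairwise_def disjnt_def using disj by (metis imageE)
    qed (auto simp: T_open)
    moreover have "inj_on T I" using T_ne disj by (intro inj_onI) (metis Int_absorb)
    ultimately have "countable I" by (rule countable_image_inj_on)
    then show False using N(1) uncountable_open_interval unfolding I_def by blast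
  qed
  show ?thesis using no_less ab by (metis linorder_neqE)
qed

lemma ell_in: "ell1 \<in> lex_set" "ell2 \<in> lex_set" by (auto simp: ell1_def ell2_def lex_set_def)

lemma ell_less: "Abs_lexcube ell1 < Abs_lexcube ell2"
  unfolding less_lexcube_def Abs_lexcube_inverse[OF ell_in(1)] Abs_lexcube_inverse[OF ell_in(2)]
  by (auto simp: less_fun_def ell1_def ell2_def)

lemma coord_in_lex_part_iff:
  "coord x \<in> lex_part j \<longleftrightarrow> (if j = 1 then x \<le> Abs_lexcube ell1
     else if j = 2 then Abs_lexcube ell1 < x \<and> x < Abs_lexcube ell2 else Abs_lexcube ell2 \<le> x)"
proof -
  obtain p q where pq: "ell1 = coord p" "ell2 = coord q"
    using ell_in Abs_lexcube_inverse by metis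
  show ?thesis
    unfolding lex_part_def pq Rep_lexcube_inverse
    by (simp add: Rep_lexcube lex_order_iff less_lexcube_def)
qed

lemma lex_part_avoiding_two:
  obtains j where "j \<in> {1..3}" "coord u \<notin> lex_part j" "coord v \<notin> lex_part j"
proof -
  let ?p = "Abs_lexcube ell1" and ?q = "Abs_lexcube ell2"
  consider "?p < u" "?p < v" | "u < ?q" "v < ?q" | "u \<le> ?p" "?q \<le> v" | "v \<le> ?p" "?q \<le> u"
    using ell_less by (meson leI order_le_less_trans)
  then show thesis
  proof cases
    case 1
    then show ?thesis by (intro that[of 1]) (auto simp: coord_in_lex_part_iff)
  next
    case 2
    then show ?thesis by (intro that[of 3]) (auto simp: coord_in_lex_part_iff)
  qed (auto intro!: that[of 2] simp: coord_in_lex_part_iff)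
qed

lemma lex_part_interval:
  "coord u \<in> lex_part j \<Longrightarrow> coord v \<in> lex_part j \<Longrightarrow> u \<le> x \<Longrightarrow> x \<le> v \<Longrightarrow> coord x \<in> lex_part j"
  unfolding coord_in_lex_part_iff by (auto split: if_splits)

section \<open>The circle as a subspace of the plane\<close>

text \<open>The parametrisation of the unit circle by \<open>[0,3)\<close>; it embeds the quotient of \<open>[0,3]\<close> in the plane.\<close>

definition circ :: "real \<Rightarrow> complex" where
  "circ t = cis (2 * pi * t / 3)"

lemma continuous_on_circ [continuous_intros]: "continuous_on S circ"
  unfolding circ_def by (intro continuous_intros) auto

lemma circ_add_3 [simp]: "circ (t + 3) = circ t"
proof -
  have "2 * pi * (t + 3) / 3 = 2 * pi * t / 3 + 2 * pi" by (simp add: field_simps)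
  then show ?thesis unfolding circ_def by (metis cis_2pi cis_mult mult.right_neutral)
qed

lemma circ_inj:
  assumes "circ s = circ t" "\<bar>s - t\<bar> < 3" shows "s = t"
proof -
  have eq: "2 * pi * s / 3 - 2 * pi * t / 3 = (2 * pi / 3) * (s - t)" by (simp add: field_simps)
  have "\<bar>2 * pi * s / 3 - 2 * pi * t / 3\<bar> = (2 * pi / 3) * \<bar>s - t\<bar>"
    unfolding eq abs_mult by simp
  also have "\<dots> < 2 * pi" using assms(2) by (simp add: field_simps)
  finally have "\<bar>Im (\<i> * complex_of_real (2 * pi * s / 3)) - Im (\<i> * complex_of_real (2 * pi * t / 3))\<bar> < 2 * pi"
    by (simp only: Im_i_times Re_complex_of_real)
  then have "\<i> * complex_of_real (2 * pi * s / 3) = \<i> * complex_of_real (2 * pi * t / 3)"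
    using assms(1) unfolding circ_def cis_conv_exp by (rule exp_complex_eqI)
  then show ?thesis by (simp add: complex_eq_iff)
qed

lemma circ_inj_circle: "s \<in> circle \<Longrightarrow> t \<in> circle \<Longrightarrow> circ s = circ t \<longleftrightarrow> s = t"
  using circ_inj[of s t] by (auto simp: circle_def)

lemma circ_circle_proj [simp]: "circ (circle_proj t) = circ t"
  using circ_add_3[of 0] by (simp add: circle_proj_def)

lemma circ_image_circle: "circ ` circle = circ ` {0..3}"
proof -
  have "circle = circle_proj ` {0..3}"
    by (force simp: circle_def circle_proj_def image_iff)
  then have "circ ` circle = (\<lambda>t. circ (circle_proj t)) ` {0..3}" by (metis image_image)
  then show ?thesis by simp
qed

lemma compact_circ_circle: "compact (circ ` circle)"
  unfolding circ_image_circle by (intro compact_continuous_image continuous_on_circ) auto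

lemma embedding_map_circ: "embedding_map circle_top euclidean circ"
proof (rule continuous_imp_embedding_map)
  have q: "quotient_map (top_of_set {0..3}) circle_top circle_proj"
    unfolding circle_top_def by (rule quotient_map_quotient_topology)
  have "circ \<circ> circle_proj = circ" by auto
  then show "continuous_map circle_top euclidean circ"
    using continuous_compose_quotient_map[OF q, of euclidean circ] continuous_on_circ by simp
  have "compactin circle_top (circle_proj ` {0..3})"
    by (rule image_compactin[OF _ quotient_imp_continuous_map[OF q]]) (simp add: compactin_subtopology)
  moreover have "circle_proj ` {0..3} = topspace circle_top"
    using q by (simp add: quotient_map_def)
  ultimately show "compact_space circle_top" by (simp add: compact_space_def)
  show "inj_on circ (topspace circle_top)" by (auto simp: inj_on_def circ_inj_circle)
qed (rule Hausdorff_space_euclidean)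

lemma continuous_map_circ: "continuous_map circle_top euclidean circ"
  using embedding_map_circ homeomorphic_imp_continuous_map continuous_map_in_subtopology
  unfolding embedding_map_def by blast

lemma openin_circle_top_iff:
  "openin circle_top U \<longleftrightarrow> (\<exists>W. open W \<and> U = {x \<in> circle. circ x \<in> W})"
proof -
  have h: "homeomorphic_map circle_top (top_of_set (circ ` circle)) circ"
    using embedding_map_circ by (simp add: embedding_map_def)
  show ?thesis
  proof
    assume U: "openin circle_top U"
    then have sub: "U \<subseteq> circle" using openin_subset[of circle_top U] by simp
    have "openin (top_of_set (circ ` circle)) (circ ` U)"
      using homeomorphic_map_openness[OF h, of U] U sub by simp
    then obtain W where "open W" "circ ` U = circ ` circle \<inter> W" by (auto simp: openin_open)
    with sub circ_inj_circle show "\<exists>W. open W \<and> U = {x \<in> circle. circ x \<in> W}"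
      by (intro exI[of _ W]) (auto simp: image_iff set_eq_iff subset_eq; metis)
  next
    assume "\<exists>W. open W \<and> U = {x \<in> circle. circ x \<in> W}"
    then show "openin circle_top U"
      using openin_continuous_map_preimage[OF continuous_map_circ]
      by auto
  qed
qed

lemma continuous_map_into_circle_top:
  assumes "\<And>r. r \<in> topspace Z \<Longrightarrow> \<gamma> r \<in> circle" "continuous_map Z euclidean (\<lambda>r. circ (\<gamma> r))"
  shows "continuous_map Z circle_top \<gamma>"
  unfolding continuous_map_def
proof (intro conjI allI impI)
  show "\<gamma> \<in> topspace Z \<rightarrow> topspace circle_top" using assms(1) by simp
  fix U assume "openin circle_top U"
  then obtain W where W: "open W" "U = {x \<in> circle. circ x \<in> W}" by (auto simp: openin_circle_top_iff)
  have "{x \<in> topspace Z. \<gamma> x \<in> U} = {x \<in> topspace Z. circ (\<gamma> x) \<in> W}" using assms(1) W(2) by auto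
  then show "openin Z {x \<in> topspace Z. \<gamma> x \<in> U}"
    using openin_continuous_map_preimage[OF assms(2), of W] W(1) by simp
qed

text \<open>Reduction modulo \<open>3\<close>, the covering map from the line to the circle \<open>[0,3)\<close>.\<close>

definition wrap :: "real \<Rightarrow> real" where
  "wrap t = t - 3 * of_int \<lfloor>t / 3\<rfloor>"

lemma wrap_circle: "wrap t \<in> circle"
proof -
  have "of_int \<lfloor>t / 3\<rfloor> \<le> t / 3" "t / 3 < of_int \<lfloor>t / 3\<rfloor> + 1" by linarith+
  then show ?thesis unfolding wrap_def circle_def atLeastLessThan_iff by linarith
qed

lemma circ_wrap: "circ (wrap t) = circ t"
proof -
  have eq: "2 * pi * t / 3 = 2 * pi * wrap t / 3 + 2 * pi * of_int \<lfloor>t / 3\<rfloor>"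
    by (simp add: wrap_def field_simps)
  show ?thesis unfolding circ_def eq cis_mult[symmetric] by simp
qed

lemma wrap_eq_iff: "\<bar>s - t\<bar> < 3 \<Longrightarrow> wrap s = wrap t \<longleftrightarrow> s = t"
  using circ_inj circ_wrap by metis

lemma wrap_id: "t \<in> circle \<Longrightarrow> wrap t = t"
  using circ_inj_circle[OF wrap_circle] circ_wrap by blast

lemma wrap_add_3: "wrap (t + 3) = wrap t"
  using circ_inj_circle[OF wrap_circle wrap_circle, of "t + 3" t]
  by (simp only: circ_wrap circ_add_3 simp_thms)

lemma continuous_map_wrap: "continuous_map euclideanreal circle_top wrap"
  by (rule continuous_map_into_circle_top) (simp_all add: wrap_circle circ_wrap continuous_on_circ)

lemma openin_circle_top_Diff_arc: "openin circle_top (circle - wrap ` {a..b})"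
proof -
  have "closed (circ ` {a..b})"
    by (intro compact_imp_closed compact_continuous_image continuous_on_circ) auto
  moreover have "circle - wrap ` {a..b} = {z \<in> circle. circ z \<in> - circ ` {a..b}}"
    using circ_inj_circle[OF _ wrap_circle] by (auto simp: circ_wrap image_iff)
  ultimately show ?thesis unfolding openin_circle_top_iff by (metis open_Compl)
qed

section \<open>Two topologies on the values of a path\<close>

lemma convergent_range_closed:
  fixes x :: "nat \<Rightarrow> 'a::t2_space"
  assumes "x \<longlonglongrightarrow> l" shows "closed (insert l (range x))"
proof -
  have "open (- insert l (range x))"
  proof (subst open_subopen, intro ballI)
    fix y assume y: "y \<in> - insert l (range x)"
    then obtain U V where UV: "open U" "open V" "y \<in> U" "l \<in> V" "U \<inter> V = {}"
      using hausdorff[of y l] by auto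
    then have "\<forall>\<^sub>F n in sequentially. x n \<in> V" using topological_tendstoD[OF assms] by blast
    then obtain N where N: "\<And>n. n \<ge> N \<Longrightarrow> x n \<in> V" by (auto simp: eventually_sequentially)
    have "open (U - x ` {..<N})" using UV(1) by (intro open_Diff finite_imp_closed) auto
    moreover have "y \<in> U - x ` {..<N}" using UV(3) y by auto
    moreover have "U - x ` {..<N} \<subseteq> - insert l (range x)"
    proof
      fix z assume z: "z \<in> U - x ` {..<N}"
      have "z \<noteq> x n" for n
        using z N[of n] UV(5) by (cases "n < N") auto
      then show "z \<in> - insert l (range x)" using z UV by auto
    qed
    ultimately show "\<exists>T. open T \<and> y \<in> T \<and> T \<subseteq> - insert l (range x)" by blast
  qed
  then show ?thesis by (simp add: closed_def)
qed

text \<open>A compact interval is not the union of countably many, but at least two, disjoint nonempty closed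
  sets.\<close>

lemma countable_closed_fibres_imp_constant:
  fixes h :: "real \<Rightarrow> 'a"
  assumes cl: "\<And>c. closed {t \<in> {a..b}. h t = c}" and count: "countable (h ` {a..b})"
    and s: "s \<in> {a..b}" and t: "t \<in> {a..b}"
  shows "h s = h t"
proof -
  define \<U> where "\<U> = (\<lambda>c. {t \<in> {a..b}. h t = c}) ` h ` {a..b}"
  have "\<U> = {{a..b}}"
  proof (rule real_Sierpinski_lemma)
    show "a \<le> b" using s by auto
    show "countable \<U>" unfolding \<U>_def using count by (rule countable_image)
  qed (use cl in \<open>auto simp: \<U>_def pairwise_def disjnt_def\<close>)
  moreover have "{r \<in> {a..b}. h r = h t} \<in> \<U>" using t unfolding \<U>_def by blast
  ultimately have "{r \<in> {a..b}. h r = h t} = {a..b}" by blast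
  with s show ?thesis by blast
qed

text \<open>Here \<open>\<gamma>\<close> and \<open>g\<close> describe one path in two topologies. A point near \<open>t\<close> at which \<open>\<gamma>\<close> is outside a
  closed neighbourhood \<open>C\<close> of \<open>\<gamma> t\<close> has \<open>g\<close> in \<open>V\<close> on a whole neighbourhood, hence \<open>\<gamma>\<close> is locally
  constant there. The set of points near \<open>t\<close> with that same value is therefore open and closed in an
  interval around \<open>t\<close>, which is impossible since \<open>\<gamma> t\<close> is a different value.\<close>

lemma isCont_of_disjunctive_continuity:
  fixes \<gamma> :: "real \<Rightarrow> 'a::t3_space" and g :: "real \<Rightarrow> 'b::t2_space"
  assumes disj: "\<And>s U V. open U \<Longrightarrow> open V \<Longrightarrow> \<gamma> s \<in> U \<Longrightarrow> g s \<in> V \<Longrightarrow>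
      \<forall>\<^sub>F r in nhds s. \<gamma> r \<in> U \<or> g r \<in> V"
    and same: "\<And>r s. \<gamma> r = \<gamma> s \<longleftrightarrow> g r = g s"
    and V: "open V" "g t \<in> V" and W0: "open W0" "t \<in> W0"
    and const: "\<And>s. s \<in> W0 \<Longrightarrow> \<forall>\<^sub>F r in nhds s. g r \<in> V \<Longrightarrow> \<forall>\<^sub>F r in nhds s. \<gamma> r = \<gamma> s"
  shows "isCont \<gamma> t"
  unfolding continuous_at_open
proof (intro allI impI)
  fix U assume "open U \<and> \<gamma> t \<in> U"
  then obtain U1 U2 where U: "open U1" "open U2" "\<gamma> t \<in> U1" "- U \<subseteq> U2" "U1 \<inter> U2 = {}"
    using t3_space[of "- U" "\<gamma> t"] by auto
  define C where "C = - U2"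
  have C: "closed C" "U1 \<subseteq> C" "C \<subseteq> U" using U by (auto simp: C_def)
  have "\<forall>\<^sub>F r in nhds t. (\<gamma> r \<in> U1 \<or> g r \<in> V) \<and> r \<in> W0"
    using disj[OF U(1) V(1) U(3) V(2)] eventually_nhds_in_open[OF W0] by eventually_elim auto
  then obtain e where e: "e > 0" "\<And>r. dist r t < e \<Longrightarrow> (\<gamma> r \<in> U1 \<or> g r \<in> V) \<and> r \<in> W0"
    by (auto simp: eventually_nhds_metric)
  define W where "W = ball t e"
  have W: "\<gamma> r \<in> U1 \<or> g r \<in> V" "r \<in> W0" if "r \<in> W" for r
    using e(2)[of r] that by (auto simp: W_def dist_commute)
  have near: "\<forall>\<^sub>F q in nhds r. q \<in> W" if "r \<in> W" for r
    using that by (intro eventually_nhds_in_open) (auto simp: W_def)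
  have loc: "\<forall>\<^sub>F q in nhds r. \<gamma> q = \<gamma> r" if r: "r \<in> W" "\<gamma> r \<notin> C" for r
  proof (rule const)
    have "g r \<in> V" using W[OF r(1)] r(2) C(2) by auto
    with disj[of "- C" V r] r(2) C(1) V(1) have "\<forall>\<^sub>F q in nhds r. \<gamma> q \<in> - C \<or> g q \<in> V" by auto
    with near[OF r(1)] show "\<forall>\<^sub>F q in nhds r. g q \<in> V" by eventually_elim (use W C(2) in blast)
  qed (rule W(2)[OF r(1)])
  have "\<gamma> r \<in> C" if r: "r \<in> W" for r
  proof (rule ccontr)
    assume nC: "\<gamma> r \<notin> C"
    define P where "P = {q. \<gamma> q = \<gamma> r}"
    have "open (W \<inter> P)"
      unfolding open_subopen[of "W \<inter> P"]
    proof
      fix q assume "q \<in> W \<inter> P"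
      then have "\<forall>\<^sub>F p in nhds q. \<gamma> p = \<gamma> q" "\<forall>\<^sub>F p in nhds q. p \<in> W"
        using nC loc[of q] near[of q] by (auto simp: P_def)
      then have "\<forall>\<^sub>F p in nhds q. p \<in> W \<inter> P"
        by eventually_elim (use \<open>q \<in> W \<inter> P\<close> in \<open>auto simp: P_def\<close>)
      then show "\<exists>T. open T \<and> q \<in> T \<and> T \<subseteq> W \<inter> P" by (auto simp: eventually_nhds)
    qed
    moreover have "open (- P)"
      unfolding open_subopen[of "- P"]
    proof
      fix q assume "q \<in> - P"
      then have "\<forall>\<^sub>F p in nhds q. \<gamma> p \<in> - {\<gamma> r} \<or> g p \<in> - {g r}"
        using same by (intro disj) (auto simp: P_def)
      then have "\<forall>\<^sub>F p in nhds q. p \<in> - P" by eventually_elim (use same in \<open>auto simp: P_def\<close>)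
      then show "\<exists>T. open T \<and> q \<in> T \<and> T \<subseteq> - P" by (auto simp: eventually_nhds)
    qed
    moreover have "connected W" by (simp add: W_def)
    ultimately have "W \<inter> P = {} \<or> W \<inter> - P = {}"
      using connectedD[of W "W \<inter> P" "- P"] by blast
    moreover have "t \<in> W" "\<gamma> t \<noteq> \<gamma> r" using e(1) nC U(3) C(2) by (auto simp: W_def)
    ultimately show False using r by (auto simp: P_def)
  qed
  then show "\<exists>S. open S \<and> t \<in> S \<and> (\<forall>x\<in>S. \<gamma> x \<in> U)"
    using C(3) e(1) by (intro exI[of _ W]) (auto simp: W_def)
qed

section \<open>Paths in the intersection of the two topologies\<close>

text \<open>The closures of the three arcs have no common point, so a small neighbourhood of \<open>z\<close> misses one of
  the arcs.\<close>

lemma small_circle_neighbourhood: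
  assumes "z \<in> circle"
  obtains i U where "i \<in> {1..3::nat}" "open U" "circ z \<in> U"
    "\<And>x. x \<in> circle \<Longrightarrow> circ x \<in> U \<Longrightarrow> x \<notin> {real i - 1..<real i}"
proof -
  \<comment> \<open>an arc whose closure does not contain the point\<close>
  define i :: nat where "i = (if z < 1 then 2 else if z < 2 then 3 else 1)"
  define U where "U = - circ ` {real i - 1..real i}"
  have "open U" unfolding U_def
    by (intro open_Compl compact_imp_closed compact_continuous_image continuous_on_circ) auto
  moreover have "circ z \<in> U"
    unfolding U_def
  proof (rule ComplI)
    assume "circ z \<in> circ ` {real i - 1..real i}"
    then obtain x where x: "x \<in> {real i - 1..real i}" "circ z = circ x" by blast
    then consider "z = x" | "x = 3" "z = 0"
      using assms circ_inj[of z x] circ_inj[of z 0] circ_add_3[of 0] by (fastforce simp: circle_def i_def split: if_splits)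
    then show False
      using x(1) assms by cases (auto simp: i_def circle_def split: if_splits)
  qed
  moreover have "i \<in> {1..3}" by (auto simp: i_def)
  moreover have "x \<notin> {real i - 1..<real i}" if "circ x \<in> U" for x
    using that by (force simp: U_def)
  ultimately show thesis using that by blast
qed

lemma small_lexcube_neighbourhood:
  obtains j V where "j \<in> {1..3::nat}" "open V" "l \<in> V" "\<And>x. x \<in> V \<Longrightarrow> coord x \<notin> lex_part j"
proof (cases "l < Abs_lexcube ell2")
  case True
  show thesis by (rule that[of 3 "{..<Abs_lexcube ell2}"]) (use True in \<open>auto simp: coord_in_lex_part_iff\<close>)
next
  case False
  then have "Abs_lexcube ell1 < l" using ell_less by simp
  then show thesis by (intro that[of 1 "{Abs_lexcube ell1<..}"]) (auto simp: coord_in_lex_part_iff)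
qed

text \<open>The data of the construction, with the properties of the bijection \<open>f\<close> that the proof uses: it maps
  \<open>A i\<close> into the arc \<open>[i-1,i)\<close> and the \<open>j\<close>-th part of \<open>L\<close> onto \<open>B j\<close>.\<close>

locale flimsy_circle =
  fixes A :: "nat \<Rightarrow> (nat \<Rightarrow> real) set"
    and B :: "nat \<Rightarrow> real set"
    and f :: "(nat \<Rightarrow> real) \<Rightarrow> real"
  assumes partition_A: "(\<Union>i\<in>{1..3}. A i) = lex_set"
    and partition_B: "(\<Union>i\<in>{1..3}. B i) = circle"
    and nine: "\<And>F. closedin (prod_topology lex_top circle_top) F \<Longrightarrow>
           countably_line_covered F \<or> (\<forall>i\<in>{1..3}. \<forall>j\<in>{1..3}. F \<inter> (A i \<times> B j) \<noteq> {})"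
    and f_bij: "bij_betw f lex_set circle"
    and f_A: "\<And>i l. i \<in> {1..3} \<Longrightarrow> l \<in> A i \<Longrightarrow> f l \<in> {real i - 1..<real i}"
    and f_part: "\<And>j. j \<in> {1..3} \<Longrightarrow> f ` lex_part j = B j"
begin

text \<open>The position in \<open>L\<close> of a point of the circle, that is, its preimage under \<open>f\<close>.\<close>

definition pos :: "real \<Rightarrow> lexcube" where
  "pos z = Abs_lexcube (inv_into lex_set f z)"

lemma f_circle: "l \<in> lex_set \<Longrightarrow> f l \<in> circle"
  using f_bij by (auto simp: bij_betw_def)

lemma topspace_flimsy [simp]: "topspace (flimsy_top f) = circle"
  by (rule topspace_flimsy_top) (use f_circle in blast)

lemma inv_f_in: "z \<in> circle \<Longrightarrow> inv_into lex_set f z \<in> lex_set"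
  using f_bij by (auto simp: bij_betw_def intro: inv_into_into)

lemma coord_pos: "z \<in> circle \<Longrightarrow> coord (pos z) = inv_into lex_set f z"
  unfolding pos_def by (simp add: Abs_lexcube_inverse inv_f_in)

lemma f_coord_pos [simp]: "z \<in> circle \<Longrightarrow> f (coord (pos z)) = z"
  using f_bij by (simp add: coord_pos bij_betw_def f_inv_into_f)

lemma pos_f [simp]: "l \<in> lex_set \<Longrightarrow> pos (f l) = Abs_lexcube l"
  using f_bij by (simp add: pos_def bij_betw_def)

lemma pos_inj: "y \<in> circle \<Longrightarrow> z \<in> circle \<Longrightarrow> pos y = pos z \<longleftrightarrow> y = z"
  using f_coord_pos by metis

lemma pos_B: "j \<in> {1..3} \<Longrightarrow> z \<in> B j \<Longrightarrow> coord (pos z) \<in> lex_part j"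
proof -
  assume j: "j \<in> {1..3}" "z \<in> B j"
  then obtain l where l: "l \<in> lex_part j" "z = f l" using f_part by blast
  moreover have "l \<in> lex_set" using l(1) by (auto simp: lex_part_def split: if_splits)
  ultimately show ?thesis by (simp add: Abs_lexcube_inverse)
qed

lemma openin_flimsy_iff:
  "openin (flimsy_top f) U \<longleftrightarrow>
     (\<exists>W. open W \<and> U = {x \<in> circle. circ x \<in> W}) \<and> (\<exists>W. open W \<and> U = {x \<in> circle. pos x \<in> W})"
proof -
  have "openin lex_top {l \<in> lex_set. f l \<in> U} \<longleftrightarrow> (\<exists>W. open W \<and> U = {x \<in> circle. pos x \<in> W})"
    if "U \<subseteq> circle"
  proof -
    have "{l \<in> lex_set. f l \<in> U} = {l \<in> lex_set. Abs_lexcube l \<in> W} \<longleftrightarrow> U = {x \<in> circle. pos x \<in> W}"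
      (is "?l \<longleftrightarrow> ?r") for W
    proof
      assume l: ?l
      show ?r
      proof (rule set_eqI)
        fix x show "x \<in> U \<longleftrightarrow> x \<in> {x \<in> circle. pos x \<in> W}"
        proof (cases "x \<in> circle")
          case True
          then have "coord (pos x) \<in> {l \<in> lex_set. f l \<in> U} \<longleftrightarrow> x \<in> U" using Rep_lexcube by simp
          moreover have "coord (pos x) \<in> {l \<in> lex_set. Abs_lexcube l \<in> W} \<longleftrightarrow> pos x \<in> W"
            using Rep_lexcube by (simp add: Rep_lexcube_inverse)
          ultimately show ?thesis using l True by simp
        qed (use that in auto)
      qed
    next
      assume ?r
      then show ?l using f_circle by auto
    qed
    then show ?thesis unfolding openin_lex_top_iff by simp
  qed
  then show ?thesis unfolding openin_flimsy_top openin_circle_top_iff by blast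
qed

text \<open>If this failed along a sequence \<open>q n\<close> tending to \<open>t\<close>, one could assume that \<open>\<gamma> (q n)\<close> tends to \<open>z\<close>
  in the circle and that its position tends to \<open>l\<close>. The values of the sequence together with \<open>z\<close> and
  \<open>f l\<close> then form a closed set for both topologies; it does not contain \<open>\<gamma> t\<close>, although \<open>\<gamma>\<close> is
  continuous.\<close>

lemma disjunctive_continuity:
  fixes \<gamma> :: "real \<Rightarrow> real"
  assumes \<gamma>: "continuous_map euclideanreal (flimsy_top f) \<gamma>"
    and U: "open U" "circ (\<gamma> t) \<in> U" and V: "open V" "pos (\<gamma> t) \<in> V"
  shows "\<forall>\<^sub>F s in nhds t. circ (\<gamma> s) \<in> U \<or> pos (\<gamma> s) \<in> V"
proof (rule ccontr)
  assume not: "\<not> ?thesis"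
  have circle: "\<gamma> s \<in> circle" for s using \<gamma> by (auto simp: continuous_map_def)
  have "\<exists>s. dist s t < inverse (real (Suc n)) \<and> circ (\<gamma> s) \<notin> U \<and> pos (\<gamma> s) \<notin> V" for n
    using not unfolding eventually_nhds_metric
    by (metis inverse_positive_iff_positive of_nat_0_less_iff zero_less_Suc)
  then obtain s where s: "\<And>n. dist (s n) t < inverse (real (Suc n))"
    "\<And>n. circ (\<gamma> (s n)) \<notin> U" "\<And>n. pos (\<gamma> (s n)) \<notin> V" by metis
  have "(\<lambda>n. dist (s n) t) \<longlonglongrightarrow> 0"
    by (rule tendsto_sandwich[OF _ _ tendsto_const LIMSEQ_inverse_real_of_nat])
      (use s(1) in \<open>auto intro: always_eventually less_imp_le\<close>)
  then have s_lim: "s \<longlonglongrightarrow> t" by (subst tendsto_dist_iff)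
  have "\<forall>n. circ (\<gamma> (s n)) \<in> circ ` circle" using circle by auto
  then obtain z r1 where z: "z \<in> circ ` circle" "strict_mono r1" "((\<lambda>n. circ (\<gamma> (s n))) \<circ> r1) \<longlonglongrightarrow> z"
    using compact_circ_circle unfolding compact_eq_seq_compact_metric seq_compact_def by metis
  obtain r2 l where l: "strict_mono r2" "(((\<lambda>n. pos (\<gamma> (s n))) \<circ> r1) \<circ> r2) \<longlonglongrightarrow> l"
    using lexcube_convergent_subsequence by blast
  define q where "q n = s (r1 (r2 n))" for n
  have q_lim: "q \<longlonglongrightarrow> t"
    using LIMSEQ_subseq_LIMSEQ[OF LIMSEQ_subseq_LIMSEQ[OF s_lim z(2)] l(1)]
    by (simp add: q_def[abs_def] comp_def)
  have zq: "(\<lambda>n. circ (\<gamma> (q n))) \<longlonglongrightarrow> z"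
    using LIMSEQ_subseq_LIMSEQ[OF z(3) l(1)] by (simp add: q_def comp_def)
  have lq: "(\<lambda>n. pos (\<gamma> (q n))) \<longlonglongrightarrow> l" using l(2) by (simp add: q_def comp_def)
  have q_out: "circ (\<gamma> (q n)) \<in> - U" "pos (\<gamma> (q n)) \<in> - V" for n using s by (auto simp: q_def)
  have zU: "z \<notin> U" 
    using closed_sequentially[of "- U", OF _ _ zq] q_out U(1) by auto
  have lV: "l \<notin> V" 
    using closed_sequentially[of "- V", OF _ _ lq] q_out V(1) by auto
  obtain z' where z': "z' \<in> circle" "z = circ z'" using z(1) by blast
  define l' where "l' = f (coord l)"
  have l': "l' \<in> circle" "pos l' = l"
    using Rep_lexcube f_circle by (auto simp: l'_def Rep_lexcube_inverse)
  define C where "C = range (\<lambda>n. \<gamma> (q n)) \<union> {z', l'}"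
  have C_sub: "C \<subseteq> circle" using circle z' l' by (auto simp: C_def)
  have "openin (flimsy_top f) (circle - C)"
    unfolding openin_flimsy_iff
  proof
    let ?K = "insert (circ l') (insert z (range (\<lambda>n. circ (\<gamma> (q n)))))"
    have "closed ?K" using convergent_range_closed[OF zq] by simp
    moreover have "circle - C = {x \<in> circle. circ x \<in> - ?K}"
      using circle z' l' by (auto simp: C_def circ_inj_circle)
    ultimately show "\<exists>W. open W \<and> circle - C = {x \<in> circle. circ x \<in> W}" by (metis open_Compl)
    let ?M = "insert (pos z') (insert l (range (\<lambda>n. pos (\<gamma> (q n)))))"
    have "closed ?M" using convergent_range_closed[OF lq] by simp
    moreover have "circle - C = {x \<in> circle. pos x \<in> - ?M}"
      using circle z' l'(1) unfolding l'(2)[symmetric] by (auto simp: C_def pos_inj)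
    ultimately show "\<exists>W. open W \<and> circle - C = {x \<in> circle. pos x \<in> W}" by (metis open_Compl)
  qed
  then have "open {r. \<gamma> r \<in> circle - C}"
    using \<gamma> by (auto simp: continuous_map_def)
  moreover have "\<gamma> t \<in> circle - C"
  proof -
    have "\<gamma> t \<noteq> \<gamma> (q n)" for n using q_out(1)[of n] U(2) by auto
    moreover have "\<gamma> t \<noteq> z'" using zU U(2) z'(2) by auto
    moreover have "\<gamma> t \<noteq> l'" using lV V(2) l'(2) by auto
    ultimately show ?thesis using circle by (auto simp: C_def)
  qed
  ultimately have "\<forall>\<^sub>F n in sequentially. q n \<in> {r. \<gamma> r \<in> circle - C}"
    by (intro topological_tendstoD[OF q_lim]) auto
  then show False by (auto simp: C_def)
qed

lemma closed_fibre:
  assumes \<gamma>: "continuous_map euclideanreal (flimsy_top f) \<gamma>"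
  shows "closed {t. \<gamma> t = c}"
proof -
  have circle: "\<gamma> s \<in> circle" for s using \<gamma> by (auto simp: continuous_map_def)
  have "open (- {t. \<gamma> t = c})"
    unfolding open_subopen[of "- {t. \<gamma> t = c}"]
  proof
    fix t assume t: "t \<in> - {t. \<gamma> t = c}"
    show "\<exists>T. open T \<and> t \<in> T \<and> T \<subseteq> - {t. \<gamma> t = c}"
    proof (cases "c \<in> circle")
      case True
      then have "\<forall>\<^sub>F s in nhds t. circ (\<gamma> s) \<in> - {circ c} \<or> pos (\<gamma> s) \<in> - {pos c}"
        using t circle by (intro disjunctive_continuity[OF \<gamma>]) (auto simp: circ_inj_circle pos_inj)
      then have "\<forall>\<^sub>F s in nhds t. \<gamma> s \<noteq> c" by eventually_elim auto
      then show ?thesis by (auto simp: eventually_nhds)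
    next
      case False
      with circle have "- {t. \<gamma> t = c} = UNIV" by auto
      then show ?thesis by auto
    qed
  qed
  then show ?thesis by (simp add: closed_def)
qed

text \<open>The step that uses the property of the nine products. The set \<open>F\<close> is the closure of the graph of
  the path in the product; by disjunctive continuity and compactness a point \<open>(l, z)\<close> of \<open>F\<close> has \<open>f l\<close> or
  \<open>z\<close> on the path. For \<open>l \<in> A i\<close> and \<open>z \<in> B j\<close> both are excluded.\<close>

lemma constant_of_small:
  assumes \<gamma>: "continuous_map euclideanreal (flimsy_top f) \<gamma>"
    and i: "i \<in> {1..3}" "\<And>t. t \<in> {a..b} \<Longrightarrow> \<gamma> t \<notin> {real i - 1..<real i}"
    and j: "j \<in> {1..3}" "\<And>t. t \<in> {a..b} \<Longrightarrow> coord (pos (\<gamma> t)) \<notin> lex_part j"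
    and st: "s \<in> {a..b}" "t \<in> {a..b}"
  shows "\<gamma> s = \<gamma> t"
proof -
  have circle: "\<gamma> s \<in> circle" for s using \<gamma> by (auto simp: continuous_map_def)
  define G where "G = (\<lambda>t. (pos (\<gamma> t), circ (\<gamma> t))) ` {a..b}"
  have reach: "\<exists>r\<in>{a..b}. pos (\<gamma> r) = l \<or> circ (\<gamma> r) = z" if lz: "(l, z) \<in> closure G" for l z
  proof (rule ccontr)
    assume no: "\<not> ?thesis"
    have "\<exists>R M Z. open R \<and> r \<in> R \<and> open M \<and> l \<in> M \<and> open Z \<and> z \<in> Z \<and>
        (\<forall>q\<in>R. pos (\<gamma> q) \<notin> M \<or> circ (\<gamma> q) \<notin> Z)" if r: "r \<in> {a..b}" for r
    proof -
      obtain V M where VM: "open V" "open M" "pos (\<gamma> r) \<in> V" "l \<in> M" "V \<inter> M = {}"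
        using no r hausdorff[of "pos (\<gamma> r)" l] by auto
      obtain U Z where UZ: "open U" "open Z" "circ (\<gamma> r) \<in> U" "z \<in> Z" "U \<inter> Z = {}"
        using no r hausdorff[of "circ (\<gamma> r)" z] by auto
      obtain R where "open R" "r \<in> R" "\<forall>q\<in>R. circ (\<gamma> q) \<in> U \<or> pos (\<gamma> q) \<in> V"
        using disjunctive_continuity[OF \<gamma> UZ(1,3) VM(1,3)] by (auto simp: eventually_nhds)
      with VM UZ show ?thesis by (metis IntI empty_iff)
    qed
    then obtain R M Z where R: "\<And>r. r \<in> {a..b} \<Longrightarrow> open (R r) \<and> r \<in> R r \<and> open (M r) \<and> l \<in> M r \<and>
        open (Z r) \<and> z \<in> Z r \<and> (\<forall>q\<in>R r. pos (\<gamma> q) \<notin> M r \<or> circ (\<gamma> q) \<notin> Z r)"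
      by metis
    obtain D where D: "D \<subseteq> {a..b}" "finite D" "{a..b} \<subseteq> (\<Union>r\<in>D. R r)"
      using compactE_image[of "{a..b}" "{a..b}" R] R by blast
    \<comment> \<open>a neighbourhood of the point that contains no point of the graph\<close>
    define N where "N = (\<Inter>r\<in>D. M r) \<times> (\<Inter>r\<in>D. Z r)"
    have "open N" unfolding N_def using D R by (intro open_Times open_INT) auto
    moreover have "(l, z) \<in> N" using D R by (auto simp: N_def)
    ultimately have "N \<inter> G \<noteq> {}" using lz open_Int_closure_eq_empty[of N G] by blast
    then obtain q where q: "q \<in> {a..b}" "(pos (\<gamma> q), circ (\<gamma> q)) \<in> N"
      unfolding G_def by blast
    then obtain r where "r \<in> D" "q \<in> R r" using D(3) by blast
    moreover from this have "pos (\<gamma> q) \<in> M r" "circ (\<gamma> q) \<in> Z r" using q(2) by (auto simp: N_def)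
    ultimately show False using R[of r] D(1) by blast
  qed
  define F where "F = {p \<in> lex_set \<times> circle. (Abs_lexcube (fst p), circ (snd p)) \<in> closure G}"
  have F_closed: "closedin (prod_topology lex_top circle_top) F"
  proof -
    have "continuous_map (prod_topology lex_top circle_top) (prod_topology euclidean euclidean)
        (\<lambda>p. (Abs_lexcube (fst p), circ (snd p)))"
      unfolding continuous_map_pairwise comp_def fst_conv snd_conv
      by (intro conjI continuous_map_compose[OF continuous_map_fst, unfolded comp_def]
          continuous_map_compose[OF continuous_map_snd, unfolded comp_def]
          homeomorphic_imp_continuous_map[OF homeomorphic_map_lex_top]
          continuous_map_circ)
    then have "closedin (prod_topology lex_top circle_top)
        {p \<in> topspace (prod_topology lex_top circle_top). (Abs_lexcube (fst p), circ (snd p)) \<in> closure G}"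
      by (rule closedin_continuous_map_preimage) (simp add: euclidean_product_topology)
    then show ?thesis by (simp add: F_def)
  qed
  have "countable (\<gamma> ` {a..b})"
    using nine[OF F_closed]
  proof
    assume "countably_line_covered F"
    then obtain \<C> where \<C>: "countable \<C>" "F \<subseteq> \<Union>\<C>"
      "\<forall>C\<in>\<C>. (\<exists>l\<in>lex_set. C = {l} \<times> circle) \<or> (\<exists>z\<in>circle. C = lex_set \<times> {z})"
      by (auto simp: countably_line_covered_def)
    define pt where "pt t = (coord (pos (\<gamma> t)), \<gamma> t)" for t
    have pt_F: "pt t \<in> F" if "t \<in> {a..b}" for t
    proof -
      have "(pos (\<gamma> t), circ (\<gamma> t)) \<in> closure G" using that closure_subset[of G] by (auto simp: G_def)
      then show ?thesis using Rep_lexcube circle by (simp add: F_def pt_def Rep_lexcube_inverse)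
    qed
    have one: "\<exists>y. \<forall>t\<in>{a..b}. pt t \<in> C \<longrightarrow> \<gamma> t = y" if C: "C \<in> \<C>" for C
    proof -
      consider l where "l \<in> lex_set" "C = {l} \<times> circle" | z where "C = lex_set \<times> {z}"
        using bspec[OF \<C>(3) C] by blast
      then show ?thesis
      proof cases
        case 1
        then have "\<forall>t\<in>{a..b}. pt t \<in> C \<longrightarrow> \<gamma> t = f l"
          using f_coord_pos[OF circle] by (auto simp: pt_def)
        then show ?thesis by blast
      qed (auto simp: pt_def)
    qed
    obtain y where y: "\<And>C t. C \<in> \<C> \<Longrightarrow> t \<in> {a..b} \<Longrightarrow> pt t \<in> C \<Longrightarrow> \<gamma> t = y C"
      using one by metis
    have "\<gamma> ` {a..b} \<subseteq> y ` \<C>"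
    proof (rule image_subsetI)
      fix t assume t: "t \<in> {a..b}"
      then obtain C where "C \<in> \<C>" "pt t \<in> C" using pt_F[OF t] \<C>(2) by blast
      then show "\<gamma> t \<in> y ` \<C>" using y[OF _ t] by blast
    qed
    then show ?thesis by (rule countable_subset) (rule countable_image[OF \<C>(1)])
  next
    assume "\<forall>i\<in>{1..3}. \<forall>j\<in>{1..3}. F \<inter> (A i \<times> B j) \<noteq> {}"
    with i(1) j(1) obtain l z where lz: "(l, z) \<in> F" "l \<in> A i" "z \<in> B j" by blast
    then have in_spaces: "l \<in> lex_set" "z \<in> circle" by (auto simp: F_def)
    have "(Abs_lexcube l, circ z) \<in> closure G" using lz(1) by (simp add: F_def)
    from reach[OF this] obtain r
      where r: "r \<in> {a..b}" "pos (\<gamma> r) = Abs_lexcube l \<or> circ (\<gamma> r) = circ z" by blast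
    from r(2) have "\<gamma> r = f l \<or> \<gamma> r = z"
      using f_coord_pos[OF circle, of r] circ_inj_circle[OF circle in_spaces(2)]
        Abs_lexcube_inverse[OF in_spaces(1)] by (elim disjE) simp_all
    then have False using i(2)[OF r(1)] j(2)[OF r(1)] f_A[OF i(1) lz(2)] pos_B[OF j(1) lz(3)] by auto
    then show ?thesis ..
  qed
  moreover have "closed {t \<in> {a..b}. \<gamma> t = c}" for c
  proof -
    have "{t \<in> {a..b}. \<gamma> t = c} = {a..b} \<inter> {t. \<gamma> t = c}" by auto
    then show ?thesis using closed_fibre[OF \<gamma>] by (simp add: closed_Int)
  qed
  ultimately show ?thesis by (rule countable_closed_fibres_imp_constant[of a b \<gamma> s t, OF _ _ st, rotated])
qed

lemma locally_constant_of_small: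
  assumes \<gamma>: "continuous_map euclideanreal (flimsy_top f) \<gamma>"
    and i: "i \<in> {1..3}" "\<forall>\<^sub>F t in nhds s. \<gamma> t \<notin> {real i - 1..<real i}"
    and j: "j \<in> {1..3}" "\<forall>\<^sub>F t in nhds s. coord (pos (\<gamma> t)) \<notin> lex_part j"
  shows "\<forall>\<^sub>F t in nhds s. \<gamma> t = \<gamma> s"
proof -
  have "\<forall>\<^sub>F t in nhds s. \<gamma> t \<notin> {real i - 1..<real i} \<and> coord (pos (\<gamma> t)) \<notin> lex_part j"
    using i(2) j(2) by (rule eventually_conj)
  then obtain d where d: "d > 0" "\<And>t. dist t s < d \<Longrightarrow>
      \<gamma> t \<notin> {real i - 1..<real i} \<and> coord (pos (\<gamma> t)) \<notin> lex_part j"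
    by (auto simp: eventually_nhds_metric)
  have "\<gamma> t = \<gamma> s" if "dist t s < d / 2" for t
  proof (rule constant_of_small[OF \<gamma> i(1) _ j(1)])
    fix r assume "r \<in> {s - d / 2..s + d / 2}"
    then have "dist r s < d" using d(1) by (auto simp: dist_real_def abs_if)
    then show "\<gamma> r \<notin> {real i - 1..<real i}" "coord (pos (\<gamma> r)) \<notin> lex_part j" using d(2) by blast+
  qed (use that d(1) in \<open>auto simp: dist_real_def abs_if split: if_splits\<close>)
  then show ?thesis unfolding eventually_nhds_metric using half_gt_zero[OF d(1)] by blast
qed

text \<open>Near \<open>s\<close> the path is continuous into \<open>L\<close>, hence constant.\<close>

lemma constant_near_of_pos_small:
  assumes \<gamma>: "continuous_map euclideanreal (flimsy_top f) \<gamma>"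
    and j: "j \<in> {1..3}" "\<forall>\<^sub>F t in nhds s. coord (pos (\<gamma> t)) \<notin> lex_part j"
  shows "\<forall>\<^sub>F t in nhds s. \<gamma> t = \<gamma> s"
proof -
  have circle: "\<gamma> r \<in> circle" for r using \<gamma> by (auto simp: continuous_map_def)
  obtain S0 where S0: "open S0" "s \<in> S0" "\<And>t. t \<in> S0 \<Longrightarrow> coord (pos (\<gamma> t)) \<notin> lex_part j"
    using j(2) by (auto simp: eventually_nhds)
  obtain e where e: "e > 0" "ball s e \<subseteq> S0" using S0 openE by blast
  define R where "R = ball s e"
  have R: "open R" "connected R" "s \<in> R" "\<And>t. t \<in> R \<Longrightarrow> coord (pos (\<gamma> t)) \<notin> lex_part j"
    using e S0(3) by (auto simp: R_def subset_eq)
  have "isCont (\<lambda>r. pos (\<gamma> r)) t" if t: "t \<in> R" for t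
  proof -
    obtain i U where iU: "i \<in> {1..3::nat}" "open U" "circ (\<gamma> t) \<in> U"
      "\<And>x. x \<in> circle \<Longrightarrow> circ x \<in> U \<Longrightarrow> x \<notin> {real i - 1..<real i}"
      using small_circle_neighbourhood[OF circle] by blast
    show ?thesis
    proof (rule isCont_of_disjunctive_continuity[where g = "\<lambda>r. circ (\<gamma> r)" and V = U and ?W0.0 = R])
      fix r V' U' assume "open V'" "open U'" "pos (\<gamma> r) \<in> V'" "circ (\<gamma> r) \<in> U'"
      then have "\<forall>\<^sub>F q in nhds r. circ (\<gamma> q) \<in> U' \<or> pos (\<gamma> q) \<in> V'"
        by (intro disjunctive_continuity[OF \<gamma>])
      then show "\<forall>\<^sub>F q in nhds r. pos (\<gamma> q) \<in> V' \<or> circ (\<gamma> q) \<in> U'" by eventually_elim blast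
    next
      fix r assume r: "r \<in> R" "\<forall>\<^sub>F q in nhds r. circ (\<gamma> q) \<in> U"
      have "\<forall>\<^sub>F q in nhds r. \<gamma> q = \<gamma> r"
      proof (rule locally_constant_of_small[OF \<gamma> iU(1) _ j(1)])
        show "\<forall>\<^sub>F q in nhds r. \<gamma> q \<notin> {real i - 1..<real i}"
          using r(2) by eventually_elim (use iU(4) circle in blast)
        show "\<forall>\<^sub>F q in nhds r. coord (pos (\<gamma> q)) \<notin> lex_part j"
          using eventually_nhds_in_open[OF R(1) r(1)] by eventually_elim (rule R(4))
      qed
      then show "\<forall>\<^sub>F q in nhds r. pos (\<gamma> q) = pos (\<gamma> r)" by eventually_elim simp
    qed (use R(1) t iU circle in \<open>auto simp: circ_inj_circle pos_inj\<close>)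
  qed
  then have "continuous_on R (\<lambda>r. pos (\<gamma> r))" by (simp add: continuous_at_imp_continuous_on)
  from lexcube_path_constant[OF this R(1,2) _ R(3)]
  have "\<gamma> t = \<gamma> s" if "t \<in> R" for t using that pos_inj circle by blast
  then show ?thesis unfolding eventually_nhds using R(1,3) by blast
qed

lemma path_continuous_on_circle:
  assumes \<gamma>: "continuous_map euclideanreal (flimsy_top f) \<gamma>"
  shows "continuous_map euclideanreal circle_top \<gamma>"
proof -
  have circle: "\<gamma> r \<in> circle" for r using \<gamma> by (auto simp: continuous_map_def)
  have "isCont (\<lambda>r. circ (\<gamma> r)) t" for t
  proof -
    obtain j V where jV: "j \<in> {1..3::nat}" "open V" "pos (\<gamma> t) \<in> V" "\<And>x. x \<in> V \<Longrightarrow> coord x \<notin> lex_part j"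
      using small_lexcube_neighbourhood by metis
    show ?thesis
    proof (rule isCont_of_disjunctive_continuity[where g = "\<lambda>r. pos (\<gamma> r)" and V = V and ?W0.0 = UNIV])
      fix r assume r: "\<forall>\<^sub>F q in nhds r. pos (\<gamma> q) \<in> V"
      have "\<forall>\<^sub>F q in nhds r. \<gamma> q = \<gamma> r"
      proof (rule constant_near_of_pos_small[OF \<gamma> jV(1)])
        show "\<forall>\<^sub>F q in nhds r. coord (pos (\<gamma> q)) \<notin> lex_part j"
          using r by eventually_elim (rule jV(4))
      qed
      then show "\<forall>\<^sub>F q in nhds r. circ (\<gamma> q) = circ (\<gamma> r)" by eventually_elim simp
    qed (use jV circle disjunctive_continuity[OF \<gamma>] in \<open>auto simp: circ_inj_circle pos_inj\<close>)
  qed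
  then have "continuous_on UNIV (\<lambda>r. circ (\<gamma> r))" by (simp add: continuous_at_imp_continuous_on)
  then show ?thesis using circle by (intro continuous_map_into_circle_top) simp_all
qed

section \<open>Removing one or two points\<close>

lemma continuous_map_flimsy_of_circle:
  "continuous_map Z circle_top \<gamma> \<Longrightarrow> continuous_map Z (flimsy_top f) \<gamma>"
  by (simp add: continuous_map_def openin_flimsy_top)

lemma continuous_map_flimsy_f: "continuous_map euclidean (flimsy_top f) (\<lambda>x. f (coord x))"
  unfolding continuous_map_def
proof (intro conjI allI impI)
  show "(\<lambda>x. f (coord x)) \<in> topspace euclidean \<rightarrow> topspace (flimsy_top f)"
    using f_circle Rep_lexcube by simp
  fix U assume "openin (flimsy_top f) U"
  then obtain W where W: "open W" "U = {z \<in> circle. pos z \<in> W}" unfolding openin_flimsy_iff by blast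
  have "{x \<in> topspace euclidean. f (coord x) \<in> U} = W"
    unfolding W(2) using f_circle Rep_lexcube by (simp add: Rep_lexcube_inverse)
  then show "openin euclidean {x \<in> topspace euclidean. f (coord x) \<in> U}" using W(1) by simp
qed

text \<open>The image of a segment of the line under \<open>wrap\<close> is a path in the circle.\<close>

lemma arc_pathin:
  assumes "\<And>t. t \<in> closed_segment a b \<Longrightarrow> wrap t \<in> S"
  shows "\<exists>g. pathin (subtopology (flimsy_top f) S) g \<and> g 0 = wrap a \<and> g 1 = wrap b"
proof (intro exI conjI)
  let ?g = "\<lambda>s. wrap ((1 - s) * a + s * b)"
  have "continuous_map (top_of_set {0..1}) euclideanreal (\<lambda>s. (1 - s) * a + s * b)"
    by (simp add: continuous_intros)
  from continuous_map_compose[OF this continuous_map_wrap]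
  have "continuous_map (top_of_set {0..1}) (flimsy_top f) ?g"
    by (intro continuous_map_flimsy_of_circle) (simp add: comp_def)
  moreover have "?g s \<in> S" if "s \<in> {0..1}" for s
    using that by (intro assms) (auto simp: in_segment)
  ultimately show "pathin (subtopology (flimsy_top f) S) ?g"
    unfolding pathin_def by (simp add: continuous_map_in_subtopology image_subset_iff)
qed auto

lemma path_connected_flimsy_Diff:
  assumes "S \<subseteq> circle" "finite S" "card S < 2"
  shows "path_connected_space (subtopology (flimsy_top f) (circle - S))"
proof -
  obtain x where x: "x \<in> circle" "S \<subseteq> {x}"
  proof (cases "S = {}")
    case True
    then show thesis by (intro that[of 0]) (auto simp: circle_def)
  next
    case False
    then have "card S = 1" using assms(2,3) by (metis One_nat_def card_0_eq less_2_cases)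
    then show thesis using that assms(1) by (auto simp: card_1_singleton_iff)
  qed
  \<comment> \<open>choose lifts in \<open>[x, x + 3)\<close>; the segment between them avoids \<open>x\<close> if \<open>x\<close> is removed\<close>
  have lift: "\<exists>t. wrap t = p \<and> t \<in> {x..<x + 3} \<and> (x \<in> S \<longrightarrow> x < t)" if p: "p \<in> circle - S" for p
  proof (cases "p < x")
    case True
    then show ?thesis
      using p x(1) by (intro exI[of _ "p + 3"]) (auto simp: wrap_add_3 wrap_id circle_def)
  next
    case False
    moreover have "x \<in> S \<Longrightarrow> p \<noteq> x" using p by auto
    ultimately show ?thesis
      using p x(1) by (intro exI[of _ p]) (auto simp: wrap_id circle_def)
  qed
  show ?thesis
    unfolding path_connected_space_def
  proof (intro ballI)
    fix p q assume "p \<in> topspace (subtopology (flimsy_top f) (circle - S))"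
      "q \<in> topspace (subtopology (flimsy_top f) (circle - S))"
    then have pq: "p \<in> circle - S" "q \<in> circle - S" by auto
    obtain a where a: "wrap a = p" "a \<in> {x..<x + 3}" "x \<in> S \<longrightarrow> x < a" using lift[OF pq(1)] by blast
    obtain b where b: "wrap b = q" "b \<in> {x..<x + 3}" "x \<in> S \<longrightarrow> x < b" using lift[OF pq(2)] by blast
    have "wrap t \<in> circle - S" if "t \<in> closed_segment a b" for t
    proof -
      have t: "t \<in> {x..<x + 3}" "x \<in> S \<longrightarrow> x < t"
        using that a b by (auto simp: closed_segment_eq_real_ivl split: if_splits)
      have "wrap t \<noteq> x" if "x \<in> S"
        using that t wrap_eq_iff[of t x] wrap_id[OF x(1)] by auto
      then show ?thesis using wrap_circle x(2) by blast
    qed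
    from arc_pathin[of a b "circle - S", OF this] show "\<exists>g. pathin (subtopology (flimsy_top f) (circle - S)) g \<and> g 0 = p \<and> g 1 = q"
      using a(1) b(1) by simp
  qed
qed

text \<open>A path in \<open>X\<close> is a path in the Euclidean circle, so if it avoids \<open>x\<close> and \<open>y\<close>, it stays in one of
  the two open arcs between them.\<close>

lemma not_path_connected_flimsy_Diff:
  assumes xy: "x \<in> circle" "y \<in> circle" "x < y"
  shows "\<not> path_connected_space (subtopology (flimsy_top f) (circle - {x, y}))"
proof
  assume conn: "path_connected_space (subtopology (flimsy_top f) (circle - {x, y}))"
  have bounds: "0 \<le> x" "y < 3" using xy by (auto simp: circle_def)
  have arc1: "circle - wrap ` {x..y} = circle - {x..y}"
  proof -
    have "wrap t = t" if "t \<in> {x..y}" for t using that bounds by (intro wrap_id) (auto simp: circle_def)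
    then show ?thesis by simp
  qed
  have arc2: "circle - wrap ` {y..x + 3} = {x<..<y}"
  proof (intro subset_antisym subsetI)
    fix z assume z: "z \<in> circle - wrap ` {y..x + 3}"
    then have "\<not> y \<le> z" using bounds wrap_id[of z] by (force simp: circle_def image_iff)
    moreover have "\<not> z \<le> x"
    proof
      assume "z \<le> x"
      then have "z + 3 \<in> {y..x + 3}" using bounds z by (auto simp: circle_def)
      then have "wrap (z + 3) \<in> wrap ` {y..x + 3}" by blast
      then show False using z wrap_id[of z] by (simp add: wrap_add_3)
    qed
    ultimately show "z \<in> {x<..<y}" by simp
  next
    fix z assume z: "z \<in> {x<..<y}"
    then have zc: "z \<in> circle" using bounds by (auto simp: circle_def)
    have "z \<noteq> wrap t" if "t \<in> {y..x + 3}" for t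
      using that z wrap_eq_iff[of z t] wrap_id[OF zc] by auto
    then show "z \<in> circle - wrap ` {y..x + 3}" using zc by blast
  qed
  define p q where "p = (x + y) / 2" and "q = (y + 3) / 2"
  have pq: "p \<in> {x<..<y}" "q \<in> circle - {x..y}" using bounds xy(3) by (auto simp: p_def q_def circle_def)
  then have "p \<in> circle - {x, y}" "q \<in> circle - {x, y}" using bounds by (auto simp: circle_def)
  then obtain g where g: "pathin (subtopology (flimsy_top f) (circle - {x, y})) g" "g 0 = p" "g 1 = q"
    using conn unfolding path_connected_space_def by auto
  \<comment> \<open>extend the path to a map that is defined on the whole line\<close>
  define \<gamma> where "\<gamma> r = g (max 0 (min 1 r))" for r
  have "continuous_map euclideanreal (top_of_set {0..1}) (\<lambda>r. max 0 (min 1 r :: real))"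
    by (auto simp: continuous_map_in_subtopology intro!: continuous_intros)
  from continuous_map_compose[OF this g(1)[unfolded pathin_def]]
  have \<gamma>: "continuous_map euclideanreal (subtopology (flimsy_top f) (circle - {x, y})) \<gamma>"
    by (simp add: comp_def \<gamma>_def[abs_def])
  then have \<gamma>_flimsy: "continuous_map euclideanreal (flimsy_top f) \<gamma>"
    by (simp add: continuous_map_in_subtopology)
  have \<gamma>_in: "\<gamma> r \<in> circle - {x, y}" for r
    using continuous_map_image_subset_topspace[OF \<gamma>] by auto
  have cont: "continuous_map euclideanreal circle_top \<gamma>"
    by (rule path_continuous_on_circle[OF \<gamma>_flimsy])
  have op: "open {r. \<gamma> r \<in> {x<..<y}}" "open {r. \<gamma> r \<in> circle - {x..y}}"
    using openin_continuous_map_preimage[OF cont openin_circle_top_Diff_arc[of y "x + 3"]]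
      openin_continuous_map_preimage[OF cont openin_circle_top_Diff_arc[of x y]]
    unfolding arc1 arc2 by simp_all
  have "UNIV \<subseteq> {r. \<gamma> r \<in> {x<..<y}} \<union> {r. \<gamma> r \<in> circle - {x..y}}"
  proof
    fix r
    show "r \<in> {r. \<gamma> r \<in> {x<..<y}} \<union> {r. \<gamma> r \<in> circle - {x..y}}" using \<gamma>_in[of r] by auto
  qed
  moreover have "{r. \<gamma> r \<in> {x<..<y}} \<inter> {r. \<gamma> r \<in> circle - {x..y}} \<inter> UNIV = {}" by auto
  ultimately have "{r. \<gamma> r \<in> {x<..<y}} \<inter> UNIV = {} \<or> {r. \<gamma> r \<in> circle - {x..y}} \<inter> UNIV = {}"
    using op by (intro connectedD[OF connected_UNIV]) auto
  moreover have "\<gamma> 0 = p" "\<gamma> 1 = q" using g by (simp_all add: \<gamma>_def)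
  ultimately show False using pq by blast
qed

lemma two_path_flimsy_flimsy: "two_path_flimsy (flimsy_top f)"
  unfolding two_path_flimsy_def topspace_flimsy
proof (intro conjI allI impI)
  have "infinite circle" unfolding circle_def by (rule infinite_Ico) simp
  then show "infinite circle \<or> 2 < card circle" ..
next
  fix S assume "S \<subseteq> circle" "finite S \<and> card S < 2"
  then show "path_connected_space (subtopology (flimsy_top f) (circle - S))"
    by (intro path_connected_flimsy_Diff) auto
next
  fix S assume S: "S \<subseteq> circle" "finite S \<and> card S = 2"
  then obtain x y where xy: "S = {x, y}" "x \<noteq> y" by (auto simp: card_2_iff)
  show "\<not> path_connected_space (subtopology (flimsy_top f) (circle - S))"
  proof (cases "x < y")
    case True
    then show ?thesis using not_path_connected_flimsy_Diff[of x y] S xy by auto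
  next
    case False
    then show ?thesis
      using not_path_connected_flimsy_Diff[of y x] S xy by (auto simp: insert_commute)
  qed
qed

end

section \<open>Paths parametrised by the lexicographic cube\<close>

lemma lex_order_Abs_iff:
  "(u, v) \<in> lex_order \<longleftrightarrow> u \<in> lex_set \<and> v \<in> lex_set \<and> Abs_lexcube u \<le> Abs_lexcube v"
proof (cases "u \<in> lex_set \<and> v \<in> lex_set")
  case True
  then obtain x y where "u = coord x" "v = coord y" using Abs_lexcube_inverse by metis
  then show ?thesis by (simp add: lex_order_iff Rep_lexcube_inverse Rep_lexcube)
qed (auto simp: lex_order_def)

lemma is_min_of_lex_set: "is_min_of lex_set lex_order m \<longleftrightarrow> m = coord bot"
proof -
  have "is_min_of lex_set lex_order m \<longleftrightarrow> m \<in> lex_set \<and> (\<forall>x. Abs_lexcube m \<le> x)"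
    using Abs_lexcube_inverse Rep_lexcube Rep_lexcube_inverse
    unfolding is_min_of_def lex_order_Abs_iff by metis
  also have "\<dots> \<longleftrightarrow> m \<in> lex_set \<and> Abs_lexcube m = bot" by (metis bot.extremum bot_unique)
  also have "\<dots> \<longleftrightarrow> m = coord bot" by (metis Abs_lexcube_inverse Rep_lexcube Rep_lexcube_inverse)
  finally show ?thesis .
qed

lemma is_max_of_lex_set: "is_max_of lex_set lex_order m \<longleftrightarrow> m = coord top"
proof -
  have "is_max_of lex_set lex_order m \<longleftrightarrow> m \<in> lex_set \<and> (\<forall>x. x \<le> Abs_lexcube m)"
    using Abs_lexcube_inverse Rep_lexcube Rep_lexcube_inverse
    unfolding is_max_of_def lex_order_Abs_iff by metis
  also have "\<dots> \<longleftrightarrow> m \<in> lex_set \<and> Abs_lexcube m = top" by (metis top.extremum top_unique)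
  also have "\<dots> \<longleftrightarrow> m = coord top" by (metis Abs_lexcube_inverse Rep_lexcube Rep_lexcube_inverse)
  finally show ?thesis .
qed

lemma bot_neq_top_lexcube: "(bot :: lexcube) \<noteq> top"
proof
  assume eq: "(bot :: lexcube) = top"
  have "x = y" for x y :: lexcube
    using bot.extremum[of x] bot.extremum[of y] top.extremum[of x] top.extremum[of y] unfolding eq by simp
  then show False using ell_less by (metis less_irrefl)
qed

lemma big_interval_lex: "big_interval lex_top lex_order"
  unfolding big_interval_def topspace_lex_top
proof (intro conjI)
  show "linear_order_on lex_set lex_order"
    unfolding linear_order_on_def partial_order_on_def preorder_on_def refl_on_def trans_def antisym_def total_on_def
    by (auto simp: lex_order_Abs_iff Abs_lexcube_inject)
  show "dense_order_on lex_set lex_order"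
    unfolding dense_order_on_def
  proof (intro conjI ballI impI)
    have "coord bot \<noteq> coord top" using bot_neq_top_lexcube by (simp add: Rep_lexcube_inject)
    then show "\<exists>x\<in>lex_set. \<exists>y\<in>lex_set. x \<noteq> y" using Rep_lexcube by blast
    fix u v assume uv: "u \<in> lex_set" "v \<in> lex_set" "(u, v) \<in> lex_order \<and> u \<noteq> v"
    then have "Abs_lexcube u < Abs_lexcube v"
      by (simp add: lex_order_Abs_iff Abs_lexcube_inject order_less_le)
    then obtain z where z: "Abs_lexcube u < z" "z < Abs_lexcube v" using dense by blast
    have "(u, coord z) \<in> lex_order" "(coord z, v) \<in> lex_order"
      using z uv by (auto simp: lex_order_Abs_iff Rep_lexcube Rep_lexcube_inverse)
    moreover have "u \<noteq> coord z" "coord z \<noteq> v" using z by (auto simp: Rep_lexcube_inverse)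
    ultimately show "\<exists>z\<in>lex_set. (u, z) \<in> lex_order \<and> u \<noteq> z \<and> (z, v) \<in> lex_order \<and> z \<noteq> v"
      using Rep_lexcube by blast
  qed
  show "complete_order_on lex_set lex_order"
    unfolding complete_order_on_def
  proof (intro allI impI)
    fix S assume S: "S \<subseteq> lex_set" "S \<noteq> {} \<and> upper_bounds_of lex_set lex_order S \<noteq> {}"
    have ub: "u \<in> upper_bounds_of lex_set lex_order S \<longleftrightarrow>
        u \<in> lex_set \<and> Sup (Abs_lexcube ` S) \<le> Abs_lexcube u" for u
      using S(1) by (auto simp: upper_bounds_of_def lex_order_Abs_iff Sup_le_iff)
    have "is_min_of (upper_bounds_of lex_set lex_order S) lex_order (coord (Sup (Abs_lexcube ` S)))"
      unfolding is_min_of_def by (simp add: ub lex_order_Abs_iff Rep_lexcube Rep_lexcube_inverse)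
    then show "\<exists>s. is_min_of (upper_bounds_of lex_set lex_order S) lex_order s" by (intro exI)
  qed
  show "\<exists>m. is_min_of lex_set lex_order m" "\<exists>m. is_max_of lex_set lex_order m"
    using is_min_of_lex_set is_max_of_lex_set by blast+
qed (rule lex_top_def)

text \<open>Two points are joined by a big path that is parametrised by \<open>L\<close>. This relation is symmetric and
  transitive, and ordinary paths become such paths by composition with the first coordinate.\<close>

definition lex_joined :: "'a topology \<Rightarrow> 'a \<Rightarrow> 'a \<Rightarrow> bool" where
  "lex_joined Y p q \<longleftrightarrow>
     (\<exists>\<gamma>. continuous_map (euclidean :: lexcube topology) Y \<gamma> \<and> \<gamma> bot = p \<and> \<gamma> top = q)"

lemma big_path_connected_space_if_lex_joined:
  assumes "\<And>p q. p \<in> topspace Y \<Longrightarrow> q \<in> topspace Y \<Longrightarrow> lex_joined Y p q"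
  shows "big_path_connected_space TYPE(nat \<Rightarrow> real) Y"
  unfolding big_path_connected_space_def
proof (intro ballI)
  fix p q assume "p \<in> topspace Y" "q \<in> topspace Y"
  then obtain \<gamma> where \<gamma>: "continuous_map (euclidean :: lexcube topology) Y \<gamma>" "\<gamma> bot = p" "\<gamma> top = q"
    using assms unfolding lex_joined_def by blast
  have "continuous_map lex_top Y (\<gamma> \<circ> Abs_lexcube)"
    using homeomorphic_imp_continuous_map[OF homeomorphic_map_lex_top] \<gamma>(1)
    by (rule continuous_map_compose)
  then have "big_path lex_top lex_order Y (\<gamma> \<circ> Abs_lexcube) p q"
    using \<gamma>(2,3)
    by (simp add: big_path_def big_interval_lex is_min_of_lex_set is_max_of_lex_set Rep_lexcube_inverse)
  then show "\<exists>(T :: (nat \<Rightarrow> real) topology) r \<gamma>. big_path T r Y \<gamma> p q" by blast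
qed

lemma coord_bot: "coord bot n = 0"
proof -
  have c: "coord (Abs_lexcube (\<lambda>_. 0)) = (\<lambda>_. 0)" by (rule coord_Abs) simp
  have "\<not> Abs_lexcube (\<lambda>_. 0) > bot"
  proof
    assume "Abs_lexcube (\<lambda>_. 0) > bot"
    then obtain n where "coord bot n < 0" unfolding less_lexcube_iff c by blast
    then show False using coord_bounds(1)[of bot n] by linarith
  qed
  then have "Abs_lexcube (\<lambda>_. 0) = bot" using bot.not_eq_extremum by blast
  with c show ?thesis by metis
qed

lemma coord_top: "coord top n = 1"
proof -
  have c: "coord (Abs_lexcube (\<lambda>_. 1)) = (\<lambda>_. 1)" by (rule coord_Abs) simp
  have "\<not> Abs_lexcube (\<lambda>_. 1) < top"
  proof
    assume "Abs_lexcube (\<lambda>_. 1) < top"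
    then obtain n where "coord top n > 1" unfolding less_lexcube_iff c by blast
    then show False using coord_bounds(2)[of top n] by linarith
  qed
  then have "Abs_lexcube (\<lambda>_. 1) = top" using top.not_eq_extremum by blast
  with c show ?thesis by metis
qed

lemma open_coord_less: "open {x. coord x 0 < c}"
proof -
  have "{x. coord x 0 < c} = {} \<or> {x. coord x 0 < c} = UNIV \<or> (\<exists>a. {x. coord x 0 < c} = {..<a})"
  proof (cases "0 \<le> c \<and> c \<le> 1")
    case True
    define a where "a = Abs_lexcube (\<lambda>i. if i = 0 then c else 0)"
    have a: "coord a = (\<lambda>i. if i = 0 then c else 0)" unfolding a_def using True by (intro coord_Abs) auto
    have "coord x 0 < c \<longleftrightarrow> x < a" for x
    proof
      assume "x < a"
      then obtain n where n: "coord x n < coord a n" "\<forall>i<n. coord x i = coord a i"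
        by (auto simp: less_lexcube_iff)
      have "n = 0"
      proof (rule ccontr)
        assume "n \<noteq> 0"
        then have "coord x n < 0" using n(1) by (simp add: a)
        then show False using coord_bounds(1)[of x n] by linarith
      qed
      then show "coord x 0 < c" using n(1) by (simp add: a)
    qed (auto simp: less_lexcube_iff a intro!: exI[of _ 0])
    then show ?thesis by blast
  next
    case False
    then consider "c < 0" | "c > 1" by linarith
    then show ?thesis
    proof cases
      case 1
      then have "\<not> coord x 0 < c" for x using coord_bounds(1)[of x 0] by linarith
      then show ?thesis by blast
    next
      case 2
      then have "coord x 0 < c" for x using coord_bounds(2)[of x 0] by linarith
      then show ?thesis by blast
    qed
  qed
  then show ?thesis by (metis open_empty open_UNIV open_lessThan)
qed

text \<open>The order-reversing involution of \<open>L\<close>.\<close>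

definition lex_flip :: "lexcube \<Rightarrow> lexcube" where
  "lex_flip x = Abs_lexcube (\<lambda>i. 1 - coord x i)"

lemma coord_lex_flip [simp]: "coord (lex_flip x) = (\<lambda>i. 1 - coord x i)"
  unfolding lex_flip_def by (rule coord_Abs) simp

lemma lex_flip_less_iff: "lex_flip x < lex_flip y \<longleftrightarrow> y < x"
  unfolding less_lexcube_iff by auto

lemma lex_flip_flip [simp]: "lex_flip (lex_flip x) = x"
  by (rule iffD1[OF Rep_lexcube_inject]) simp

lemma continuous_on_lex_flip: "continuous_on UNIV lex_flip"
proof -
  have "{x. lex_flip x < a} = {lex_flip a<..}" "{x. a < lex_flip x} = {..<lex_flip a}" for a
    using lex_flip_less_iff[of _ "lex_flip a"] lex_flip_less_iff[of "lex_flip a"] by auto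
  then have "open {x. lex_flip x < a}" "open {x. a < lex_flip x}" for a by simp_all
  then show ?thesis
    unfolding continuous_on_eq_continuous_at[OF open_UNIV] isCont_def
    by (intro ballI order_tendstoI) (auto simp: eventually_at_filter eventually_nhds)
qed

lemma continuous_on_coord_0: "continuous_on UNIV (\<lambda>x. coord x 0)"
proof -
  have eq: "{x. c < coord x 0} = lex_flip -` {x. coord x 0 < 1 - c}" for c by auto
  have "open {x. c < coord x 0}" for c
    unfolding eq by (rule open_vimage[OF open_coord_less continuous_on_lex_flip])
  then show ?thesis
    using open_coord_less unfolding continuous_on_eq_continuous_at[OF open_UNIV] isCont_def
    by (intro ballI order_tendstoI) (auto simp: eventually_at_filter eventually_nhds)
qed

lemma lex_joined_sym: "lex_joined Y p q \<Longrightarrow> lex_joined Y q p"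
proof -
  assume "lex_joined Y p q"
  then obtain \<gamma> where \<gamma>: "continuous_map (euclidean :: lexcube topology) Y \<gamma>" "\<gamma> bot = p" "\<gamma> top = q"
    by (auto simp: lex_joined_def)
  have flip: "lex_flip bot = top" "lex_flip top = bot"
    by (rule iffD1[OF Rep_lexcube_inject]; simp add: coord_bot coord_top fun_eq_iff)+
  have "continuous_map euclidean Y (\<gamma> \<circ> lex_flip)"
    using continuous_on_lex_flip \<gamma>(1)
    by (rule continuous_map_compose[OF iffD2[OF continuous_map_iff_continuous2]])
  then show ?thesis unfolding lex_joined_def using \<gamma>(2,3) flip by (intro exI[of _ "\<gamma> \<circ> lex_flip"]) simp
qed

lemma lex_joined_of_pathin: "pathin Y g \<Longrightarrow> lex_joined Y (g 0) (g 1)"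
proof -
  assume g: "pathin Y g"
  have "continuous_map euclidean (top_of_set {0..1}) (\<lambda>x. coord x 0)"
    using continuous_on_coord_0 by (simp add: continuous_map_in_subtopology image_subset_iff)
  then have "continuous_map euclidean Y (g \<circ> (\<lambda>x. coord x 0))"
    using g unfolding pathin_def by (rule continuous_map_compose)
  then show ?thesis
    unfolding lex_joined_def by (intro exI[of _ "g \<circ> (\<lambda>x. coord x 0)"]) (simp add: coord_bot coord_top)
qed

text \<open>A monotone surjection of \<open>L\<close> to itself that expands the elements with first coordinate at most \<open>1/3\<close>
  onto \<open>L\<close> and sends all others to the maximum.\<close>

definition stretch_low :: "lexcube \<Rightarrow> lexcube" where
  "stretch_low x = (if 3 * coord x 0 \<le> 1 then Abs_lexcube ((coord x)(0 := 3 * coord x 0)) else top)"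

lemma coord_stretch_low:
  "coord (stretch_low x) = (if 3 * coord x 0 \<le> 1 then (coord x)(0 := 3 * coord x 0) else (\<lambda>_. 1))"
  unfolding stretch_low_def using coord_Abs[of "(coord x)(0 := 3 * coord x 0)"]
  by (auto simp: coord_top)

lemma mono_stretch_low:
  assumes "x \<le> y" shows "stretch_low x \<le> stretch_low y"
proof (cases "x = y")
  case False
  then obtain n where n: "coord x n < coord y n" "\<forall>i<n. coord x i = coord y i"
    using assms by (auto simp: order_le_less less_lexcube_iff)
  have xy0: "coord x 0 \<le> coord y 0" using n by (cases "n = 0") auto
  show ?thesis
  proof (cases "3 * coord y 0 \<le> 1")
    case True
    then have "stretch_low x < stretch_low y"
      unfolding less_lexcube_iff coord_stretch_low using xy0 n by (intro exI[of _ n]) auto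
    then show ?thesis by simp
  next
    case False
    then show ?thesis by (simp add: stretch_low_def)
  qed
qed simp

lemma surj_stretch_low: "surj stretch_low"
proof (rule surjI)
  fix y
  define x where "x = Abs_lexcube ((coord y)(0 := coord y 0 / 3))"
  have "coord x = (coord y)(0 := coord y 0 / 3)"
    unfolding x_def
  proof (rule coord_Abs)
    fix n show "0 \<le> ((coord y)(0 := coord y 0 / 3)) n \<and> ((coord y)(0 := coord y 0 / 3)) n \<le> 1"
      using coord_bounds(2)[of y 0] by (auto simp del: coord_bounds(2) simp: coord_bounds(2)[of y n])
  qed
  then have "coord (stretch_low x) = coord y" by (auto simp: coord_stretch_low fun_eq_iff)
  then show "stretch_low (Abs_lexcube ((coord y)(0 := coord y 0 / 3))) = y"
    by (simp add: Rep_lexcube_inject x_def)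
qed

lemma continuous_on_stretch_low: "continuous_on UNIV stretch_low"
  by (rule continuous_onI_mono) (auto simp: surj_stretch_low mono_stretch_low)

text \<open>The first path runs while the first coordinate is at most \<open>1/3\<close>, the second, written as the flip
  of its reverse, while it is at least \<open>2/3\<close>. In between both pieces are constant with the common value \<open>q\<close>, so
  they agree on an open set and can be glued.\<close>

lemma lex_joined_trans:
  assumes "lex_joined Y p q" "lex_joined Y q r" shows "lex_joined Y p r"
proof -
  obtain \<gamma>1 where \<gamma>1: "continuous_map (euclidean :: lexcube topology) Y \<gamma>1" "\<gamma>1 bot = p" "\<gamma>1 top = q"
    using assms(1) by (auto simp: lex_joined_def)
  obtain \<gamma>2 where \<gamma>2: "continuous_map (euclidean :: lexcube topology) Y \<gamma>2" "\<gamma>2 bot = r" "\<gamma>2 top = q"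
    using lex_joined_sym[OF assms(2)] by (auto simp: lex_joined_def)
  have c1: "continuous_map euclidean Y (\<lambda>x. \<gamma>1 (stretch_low x))"
    using continuous_on_stretch_low \<gamma>1(1)
    by (rule continuous_map_compose[OF iffD2[OF continuous_map_iff_continuous2], unfolded comp_def])
  have "continuous_on UNIV (\<lambda>x. stretch_low (lex_flip x))"
    by (rule continuous_on_compose2[OF continuous_on_stretch_low continuous_on_lex_flip]) simp
  then have c2: "continuous_map euclidean Y (\<lambda>x. \<gamma>2 (stretch_low (lex_flip x)))"
    using \<gamma>2(1)
    by (rule continuous_map_compose[OF iffD2[OF continuous_map_iff_continuous2], unfolded comp_def])
  define \<gamma> where "\<gamma> x = (if coord x 0 \<le> 1 / 2 then \<gamma>1 (stretch_low x) else \<gamma>2 (stretch_low (lex_flip x)))" for x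
  have low: "\<gamma> x = \<gamma>1 (stretch_low x)" if "coord x 0 < 2 / 3" for x
    using that \<gamma>1(3) \<gamma>2(3) by (auto simp: \<gamma>_def stretch_low_def)
  have high: "\<gamma> x = \<gamma>2 (stretch_low (lex_flip x))" if "1 / 3 < coord x 0" for x
    using that \<gamma>1(3) \<gamma>2(3) by (auto simp: \<gamma>_def stretch_low_def)
  have cover: "coord x 0 < 2 / 3 \<or> 1 / 3 < coord x 0" for x by linarith
  have "continuous_map euclidean Y \<gamma>"
    unfolding continuous_map_def
  proof (intro conjI allI impI)
    show "\<gamma> \<in> topspace euclidean \<rightarrow> topspace Y"
      using c1 c2 by (auto simp: \<gamma>_def continuous_map_def Pi_iff)
    fix U assume U: "openin Y U"
    have eq: "{x \<in> topspace euclidean. \<gamma> x \<in> U} =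
        ({x. coord x 0 < 2 / 3} \<inter> {x. \<gamma>1 (stretch_low x) \<in> U}) \<union>
        ({x. 1 / 3 < coord x 0} \<inter> {x. \<gamma>2 (stretch_low (lex_flip x)) \<in> U})" (is "?L = ?R")
    proof (rule set_eqI)
      fix x show "x \<in> ?L \<longleftrightarrow> x \<in> ?R" using low[of x] high[of x] cover[of x] by auto
    qed
    have "open {x. 1 / 3 < coord x 0}"
      using open_Collect_less[OF continuous_on_const continuous_on_coord_0] .
    moreover have "open {x. \<gamma>1 (stretch_low x) \<in> U}" "open {x. \<gamma>2 (stretch_low (lex_flip x)) \<in> U}"
      using openin_continuous_map_preimage[OF c1 U] openin_continuous_map_preimage[OF c2 U] by simp_all
    ultimately show "openin euclidean {x \<in> topspace euclidean. \<gamma> x \<in> U}"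
      unfolding eq open_openin[symmetric] using open_coord_less by (intro open_Un open_Int)
  qed
  moreover have "stretch_low bot = bot" "stretch_low (lex_flip top) = bot"
    by (rule iffD1[OF Rep_lexcube_inject]; simp add: coord_stretch_low coord_bot coord_top fun_eq_iff)+
  ultimately show ?thesis
    unfolding lex_joined_def using \<gamma>1(2) \<gamma>2(2)
    by (intro exI[of _ \<gamma>]) (simp add: \<gamma>_def coord_bot coord_top)
qed

section \<open>Joining points of the doubly punctured space by big paths\<close>

context flimsy_circle
begin

text \<open>The closed set \<open>L \<times> [a,b]\<close> is not covered by countably many lines, since both factors are uncountable.\<close>

lemma B_meets_arc:
  assumes j: "j \<in> {1..3}" and ab: "a < b" "{a..b} \<subseteq> circle"
  shows "B j \<inter> {a..b} \<noteq> {}"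
proof -
  have wrap: "wrap ` {a..b} = {a..b}" using ab(2) wrap_id by (force simp: image_iff)
  have "closedin circle_top {a..b}"
    using openin_circle_top_Diff_arc[of a b] ab(2) by (simp add: closedin_def wrap)
  moreover have "closedin lex_top lex_set" using closedin_topspace[of lex_top] by simp
  ultimately have "closedin (prod_topology lex_top circle_top) (lex_set \<times> {a..b})"
    by (simp add: closedin_prod_Times_iff)
  from nine[OF this] show ?thesis
  proof
    assume "countably_line_covered (lex_set \<times> {a..b})"
    then obtain \<C> where \<C>: "countable \<C>" "lex_set \<times> {a..b} \<subseteq> \<Union>\<C>"
      "\<forall>C\<in>\<C>. (\<exists>l\<in>lex_set. C = {l} \<times> circle) \<or> (\<exists>z\<in>circle. C = lex_set \<times> {z})"
      unfolding countably_line_covered_def by blast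
    have "\<forall>C\<in>\<C>. \<exists>l z. C \<subseteq> {p. fst p = l \<or> snd p = z}" using \<C>(3) by fastforce
    then obtain l z where lz: "\<And>C. C \<in> \<C> \<Longrightarrow> C \<subseteq> {p. fst p = l C \<or> snd p = z C}" by metis
    have "inj_on (\<lambda>t _. t :: real) {0..1}" by (auto simp: inj_on_def fun_eq_iff)
    moreover have "(\<lambda>t _. t) ` {0..1::real} \<subseteq> lex_set" by (auto simp: lex_set_def)
    ultimately have "uncountable lex_set"
      using countable_subset countable_image_inj_on uncountable_closed_interval[of 0 1] zero_less_one by metis
    then have "\<not> lex_set \<subseteq> l ` \<C>" using \<C>(1) countable_image countable_subset by blast
    then obtain l0 where l0: "l0 \<in> lex_set" "l0 \<notin> l ` \<C>" by blast
    have "\<not> {a..b} \<subseteq> z ` \<C>"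
      using \<C>(1) ab(1) countable_image countable_subset uncountable_closed_interval by blast
    then obtain z0 where z0: "z0 \<in> {a..b}" "z0 \<notin> z ` \<C>" by blast
    obtain C where C: "C \<in> \<C>" "(l0, z0) \<in> C" using \<C>(2) l0(1) z0(1) by blast
    then have "l0 = l C \<or> z0 = z C" using lz[OF C(1)] by auto
    with C(1) l0(2) z0(2) show ?thesis by blast
  next
    assume "\<forall>i\<in>{1..3}. \<forall>j\<in>{1..3}. (lex_set \<times> {a..b}) \<inter> (A i \<times> B j) \<noteq> {}"
    then have "(lex_set \<times> {a..b}) \<inter> (A 1 \<times> B j) \<noteq> {}" using j by (meson atLeastAtMost_iff one_le_numeral order_refl)
    then show ?thesis by auto
  qed
qed

text \<open>An interval of \<open>L\<close> is the image of \<open>L\<close> under truncation at its end points.\<close>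

lemma lex_joined_interval:
  assumes "u \<le> v" "\<And>x. u \<le> x \<Longrightarrow> x \<le> v \<Longrightarrow> f (coord x) \<in> S"
  shows "lex_joined (subtopology (flimsy_top f) S) (f (coord u)) (f (coord v))"
proof -
  let ?c = "\<lambda>x. max u (min v x)"
  have "continuous_on UNIV ?c" by (intro continuous_intros)
  then have "continuous_map euclidean (flimsy_top f) (\<lambda>x. f (coord (?c x)))"
    using continuous_map_flimsy_f
    by (rule continuous_map_compose[OF iffD2[OF continuous_map_iff_continuous2], unfolded comp_def])
  moreover have "f (coord (?c x)) \<in> S" for x using assms by (intro assms(2)) auto
  ultimately have "continuous_map euclidean (subtopology (flimsy_top f) S) (\<lambda>x. f (coord (?c x)))"
    by (simp add: continuous_map_in_subtopology image_subset_iff)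
  moreover have "?c bot = u" "?c top = v" using assms(1) by (simp_all add: max_def min_def bot_unique top_unique)
  ultimately show ?thesis unfolding lex_joined_def by (intro exI[of _ "\<lambda>x. f (coord (?c x))"]) simp
qed

lemma lex_joined_flimsy_Diff:
  assumes xy: "x \<in> circle" "y \<in> circle" "x < y" and pq: "p \<in> circle - {x, y}" "q \<in> circle - {x, y}"
  shows "lex_joined (subtopology (flimsy_top f) (circle - {x, y})) p q"
proof -
  let ?J = "lex_joined (subtopology (flimsy_top f) (circle - {x, y}))"
  have bounds: "0 \<le> x" "y < 3" using xy by (auto simp: circle_def)
  have arc: "?J (wrap a) (wrap b)"
    if "a \<in> {x<..<y} \<and> b \<in> {x<..<y} \<or> a \<in> {y<..<x + 3} \<and> b \<in> {y<..<x + 3}" for a b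
  proof -
    have "wrap t \<in> circle - {x, y}" if "t \<in> closed_segment a b" for t
    proof -
      have "x < t \<and> t < y \<or> y < t \<and> t < x + 3"
        using that \<open>a \<in> {x<..<y} \<and> b \<in> {x<..<y} \<or> a \<in> {y<..<x + 3} \<and> b \<in> {y<..<x + 3}\<close>
        by (auto simp: closed_segment_eq_real_ivl split: if_splits)
      then have "wrap t \<noteq> wrap x" "wrap t \<noteq> wrap y"
        using xy(3) bounds by (auto simp: wrap_eq_iff)
      then show ?thesis using wrap_circle wrap_id xy(1,2) by auto
    qed
    from arc_pathin[of a b "circle - {x, y}", OF this] show ?thesis using lex_joined_of_pathin by metis
  qed
  obtain j where j: "j \<in> {1..3}" "coord (pos x) \<notin> lex_part j" "coord (pos y) \<notin> lex_part j"
    using lex_part_avoiding_two by blast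
  have "B j \<inter> {(2 * x + y) / 3..(x + 2 * y) / 3} \<noteq> {}"
    using xy(3) bounds by (intro B_meets_arc j(1)) (auto simp: circle_def)
  then obtain z1 where z1: "z1 \<in> B j" "z1 \<in> {x<..<y}" using xy(3) by fastforce
  have "B j \<inter> {(2 * y + 3) / 3..(y + 6) / 3} \<noteq> {}"
    using xy(3) bounds by (intro B_meets_arc j(1)) (auto simp: circle_def)
  then obtain z2 where z2: "z2 \<in> B j" "z2 \<in> {y<..<3}" using bounds by fastforce
  have z_circle: "z1 \<in> circle" "z2 \<in> circle" using z1 z2 bounds xy(3) by (auto simp: circle_def)
  have through: "?J (f (coord u)) (f (coord v))"
    if uv: "coord u \<in> lex_part j" "coord v \<in> lex_part j" "u \<le> v" for u v
  proof (rule lex_joined_interval[OF uv(3)])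
    fix w assume "u \<le> w" "w \<le> v"
    then have w: "coord w \<in> lex_part j" using uv lex_part_interval by blast
    have "f (coord w) \<noteq> z" if "z \<in> {x, y}" for z
    proof
      assume "f (coord w) = z"
      then have "w = pos z" by (metis Rep_lexcube Rep_lexcube_inverse pos_f)
      then show False using w j that by auto
    qed
    then show "f (coord w) \<in> circle - {x, y}" using f_circle Rep_lexcube by blast
  qed
  \<comment> \<open>the two arcs are joined through the \<open>j\<close>-th part of \<open>L\<close>\<close>
  have z12: "?J z1 z2"
  proof (cases "pos z1 \<le> pos z2")
    case True
    then show ?thesis using through[OF pos_B[OF j(1) z1(1)] pos_B[OF j(1) z2(1)]] z_circle by simp
  next
    case False
    then show ?thesis
      using lex_joined_sym[OF through[OF pos_B[OF j(1) z2(1)] pos_B[OF j(1) z1(1)]]] z_circle by simp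
  qed
  have to_z1: "?J r z1" if r: "r \<in> circle - {x, y}" for r
  proof -
    consider "r \<in> {x<..<y}" | "y < r" | "r < x" using r by fastforce
    then show ?thesis
    proof cases
      case 1
      then show ?thesis using arc[of r z1] z1(2) wrap_id r z_circle by simp
    next
      case 2
      then have "?J r z2"
        using arc[of r z2] z2(2) wrap_id r z_circle bounds by (auto simp: circle_def)
      then show ?thesis by (rule lex_joined_trans[OF _ lex_joined_sym[OF z12]])
    next
      case 3
      then have "?J (wrap (r + 3)) z2"
        using arc[of "r + 3" z2] z2(2) wrap_id r z_circle bounds by (auto simp: circle_def)
      then have "?J r z2" using r by (simp add: wrap_add_3 wrap_id)
      then show ?thesis by (rule lex_joined_trans[OF _ lex_joined_sym[OF z12]])
    qed
  qed
  show ?thesis using lex_joined_trans[OF to_z1[OF pq(1)] lex_joined_sym[OF to_z1[OF pq(2)]]] .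
qed

lemma big_path_connected_flimsy_Diff:
  assumes "x \<in> circle" "y \<in> circle" "x \<noteq> y"
  shows "big_path_connected_space TYPE(nat \<Rightarrow> real) (subtopology (flimsy_top f) (circle - {x, y}))"
proof (rule big_path_connected_space_if_lex_joined)
  fix p q assume "p \<in> topspace (subtopology (flimsy_top f) (circle - {x, y}))"
    "q \<in> topspace (subtopology (flimsy_top f) (circle - {x, y}))"
  then have pq: "p \<in> circle - {x, y}" "q \<in> circle - {x, y}" by auto
  show "lex_joined (subtopology (flimsy_top f) (circle - {x, y})) p q"
  proof (cases "x < y")
    case True
    then show ?thesis using lex_joined_flimsy_Diff assms pq by blast
  next
    case False
    then show ?thesis
      using lex_joined_flimsy_Diff[of y x p q] assms pq by (simp add: insert_commute)
  qed
qed

end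

theorem theorem8p5:
  fixes A :: "nat \<Rightarrow> (nat \<Rightarrow> real) set"
    and B :: "nat \<Rightarrow> real set"
    and fij :: "nat \<Rightarrow> nat \<Rightarrow> (nat \<Rightarrow> real) \<Rightarrow> real"
    and f :: "(nat \<Rightarrow> real) \<Rightarrow> real"
  assumes "indexed_partition3 lex_set A"
    and "indexed_partition3 circle B"
    and "\<And>F. closedin (prod_topology lex_top circle_top) F \<Longrightarrow>
           countably_line_covered F \<or>
           (\<forall>i\<in>{1..3}. \<forall>j\<in>{1..3}. F \<inter> (A i \<times> B j) \<noteq> {})"
    and "\<And>i j. i \<in> {1..3} \<Longrightarrow> j \<in> {1..3} \<Longrightarrow>
           bij_betw (fij i j) (A i \<inter> lex_part j) ({real i - 1..<real i} \<inter> B j)"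
    and "\<And>i j l. i \<in> {1..3} \<Longrightarrow> j \<in> {1..3} \<Longrightarrow> l \<in> A i \<inter> lex_part j \<Longrightarrow>
           f l = fij i j l"
  shows "two_path_flimsy (flimsy_top f) \<and>
         (\<forall>x\<in>topspace (flimsy_top f). \<forall>y\<in>topspace (flimsy_top f). x \<noteq> y \<longrightarrow>
            big_path_connected_space TYPE(nat \<Rightarrow> real)
              (subtopology (flimsy_top f) (topspace (flimsy_top f) - {x, y})))"
proof -
  have A: "(\<Union>i\<in>{1..3}. A i) = lex_set" and B: "(\<Union>i\<in>{1..3}. B i) = circle"
    and B_disj: "disjoint_family_on B {1..3}"
    using assms(1,2) by (auto simp: indexed_partition3_def)
  have f_bij_piece: "bij_betw f (A i \<inter> lex_part j) ({real i - 1..<real i} \<inter> B j)"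
    if "i \<in> {1..3}" "j \<in> {1..3}" for i j
    using assms(4)[OF that] assms(5)[OF that] by (metis bij_betw_cong)
  have piece: "\<exists>i\<in>{1..3}. \<exists>j\<in>{1..3}. l \<in> A i \<inter> lex_part j" if l: "l \<in> lex_set" for l
  proof -
    obtain x where x: "l = coord x" using l Abs_lexcube_inverse by metis
    have "\<exists>j\<in>{1, 2, 3}. coord x \<in> lex_part j" unfolding coord_in_lex_part_iff by auto
    then have "\<exists>j\<in>{1..3}. l \<in> lex_part j" unfolding x by fastforce
    then show ?thesis using l A by blast
  qed
  have arcs: "\<exists>i\<in>{1..3::nat}. z \<in> {real i - 1..<real i}" if "z \<in> circle" for z
  proof -
    have "\<exists>i\<in>{1, 2, 3::nat}. z \<in> {real i - 1..<real i}" using that by (auto simp: circle_def)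
    then show ?thesis by fastforce
  qed
  have arcs_unique: "i = i'" if "z \<in> {real i - 1..<real i}" "z \<in> {real i' - 1..<real i'}" for i i' z
    using that by auto
  interpret flimsy_circle A B f
  proof
    show "(\<Union>i\<in>{1..3}. A i) = lex_set" "(\<Union>i\<in>{1..3}. B i) = circle" by fact+
    show "countably_line_covered F \<or> (\<forall>i\<in>{1..3}. \<forall>j\<in>{1..3}. F \<inter> (A i \<times> B j) \<noteq> {})"
      if "closedin (prod_topology lex_top circle_top) F" for F using assms(3)[OF that] .
    show f_A: "f l \<in> {real i - 1..<real i}" if "i \<in> {1..3}" "l \<in> A i" for i l
    proof -
      have "l \<in> lex_set" using that A by blast
      then obtain j where j: "j \<in> {1..3}" "l \<in> lex_part j" using piece by blast
      then show ?thesis using bij_betw_apply[OF f_bij_piece[OF that(1) j(1)], of l] that(2) by blast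
    qed
    have lex_part_sub: "lex_part j \<subseteq> lex_set" for j by (auto simp: lex_part_def)
    show f_part: "f ` lex_part j = B j" if j: "j \<in> {1..3}" for j
    proof (intro subset_antisym subsetI)
      fix z assume "z \<in> f ` lex_part j"
      then obtain l where l: "l \<in> lex_part j" "z = f l" by blast
      then obtain i where i: "i \<in> {1..3}" "l \<in> A i" using A lex_part_sub by blast
      then show "z \<in> B j" using bij_betw_apply[OF f_bij_piece[OF i(1) j], of l] l by blast
    next
      fix z assume z: "z \<in> B j"
      then have "z \<in> circle" using B j by blast
      then obtain i where i: "i \<in> {1..3::nat}" "z \<in> {real i - 1..<real i}" using arcs by blast
      then have "z \<in> f ` (A i \<inter> lex_part j)"
        using bij_betw_imp_surj_on[OF f_bij_piece[OF i(1) j]] z by blast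
      then show "z \<in> f ` lex_part j" by blast
    qed
    show "bij_betw f lex_set circle"
      unfolding bij_betw_def
    proof
      show "inj_on f lex_set"
      proof (rule inj_onI)
        fix l m assume lm: "l \<in> lex_set" "m \<in> lex_set" "f l = f m"
        obtain i j where ij: "i \<in> {1..3}" "j \<in> {1..3}" "l \<in> A i \<inter> lex_part j" using piece[OF lm(1)] by blast
        obtain i' j' where ij': "i' \<in> {1..3}" "j' \<in> {1..3}" "m \<in> A i' \<inter> lex_part j'" using piece[OF lm(2)] by blast
        have "i = i'" using f_A[of i l] f_A[of i' m] ij ij' lm(3) arcs_unique by auto
        moreover have "f l \<in> B j" "f l \<in> B j'" using f_part ij ij' lm(3) by blast+
        then have "j = j'" using B_disj ij(2) ij'(2) unfolding disjoint_family_on_def by blast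
        ultimately show "l = m"
          using bij_betw_imp_inj_on[OF f_bij_piece[OF ij(1,2)]] ij(3) ij'(3) lm(3) by (auto dest: inj_onD)
      qed
      have "(\<Union>j\<in>{1..3}. lex_part j) = lex_set" using piece lex_part_sub by blast
      then have "f ` lex_set = (\<Union>j\<in>{1..3}. f ` lex_part j)" by (metis image_UN)
      also have "\<dots> = circle" using f_part B by simp
      finally show "f ` lex_set = circle" .
    qed
  qed
  show ?thesis
    unfolding topspace_flimsy using two_path_flimsy_flimsy big_path_connected_flimsy_Diff by blast
qed

end
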